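(* Let $K$ be a compact connected metrizable space. Assume that there are compact subsets $K_m$, $m \in \mathbb{N}$, of $K$ with the following properties. (1) $K_m \subsetneq K_{m+1}$ for every $m \in \mathbb{N}$. (2) $K_m$ is connected and locally connected for every $m \in \mathbb{N}$. (3) The interior of $K_m$ in $K$ is dense in $K_m$ for every $m \in \mathbb{N}$. (4) For every $m \in \mathbb{N}$, every point of $K_m$ is a point of local connectedness in $K$ (i.e. $K$ is locally connected at every point of $K_m$). (5) The set $\bigcup_{m=1}^\infty K_m$ is dense in $K$. (6) For every point $k \in K \setminus \bigcup_{m=1}^\infty K_m$ there is a path in $K$ from $k$ to a point in $\bigcup_{m=1}^\infty K_m$. Then $K \in \mathcal{DCP}$.
   Context: For a compact Hausdorff space $K$, let $C(K)$ be the Banach space (with the supremum norm) of all real-valued or complex-valued continuous functions on $K$. For $f \in C(K)$ the corresponding multiplication operator $F$ on $C(K)$ is $(Fx)(t) = f(t)x(t)$, $x \in C(K)$, $t \in K$. The double commutant $\{F\}^{cc}$ of $F$ is the set of all bounded linear operators on $C(K)$ that commute with every bounded linear operator on $C(K)$ commuting with $F$. $\mathcal{A}_F$ denotes the closure in the operator norm of the algebra generated by $F$ and the identity operator $I$ (for multiplication operators on $C(K)$ this is the same as the closure of that algebra in the weak or strong operator topology). The notation $K \in \mathcal{DCP}$ (double commutant property) means: for every real-valued $f \in C(K)$, with corresponding multiplication operator $F$, one has $\{F\}^{cc} = \mathcal{A}_F$. *)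

theory Defs
  imports "HOL-Analysis.Analysis"
begin

text \<open>
  The space \<open>K\<close> is the universe of a type \<open>'a\<close>, and the scalar field is a type
  \<open>'b\<close>, to be instantiated with \<open>real\<close> or \<open>complex\<close>. When \<open>K\<close> is compact, every
  continuous function on it is bounded, so \<open>'a \<Rightarrow>\<^sub>C 'b\<close> with the supremum norm is
  the Banach space \<open>C(K)\<close>.
\<close>

setup_lifting type_definition_bcontfun

lift_definition mult_bcontfun ::
  "('a::topological_space \<Rightarrow>\<^sub>C 'b::real_normed_field) \<Rightarrow> ('a \<Rightarrow>\<^sub>C 'b) \<Rightarrow> ('a \<Rightarrow>\<^sub>C 'b)"
  is "\<lambda>f x t. f t * x t"
proof -
  fix f x :: "'a \<Rightarrow> 'b"
  assume "f \<in> bcontfun" and "x \<in> bcontfun"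
  then have cont: "continuous_on UNIV f" "continuous_on UNIV x"
    and "bounded (range f)" "bounded (range x)"
    by (auto simp: bcontfun_def)
  then obtain a b where ab: "\<And>t. norm (f t) \<le> a" "\<And>t. norm (x t) \<le> b"
    unfolding bounded_iff by auto
  have "norm (f t * x t) \<le> a * b" for t
    unfolding norm_mult using ab[of t] norm_ge_zero order_trans
    by (intro mult_mono) blast+
  with cont show "(\<lambda>t. f t * x t) \<in> bcontfun"
    by (intro bcontfun_normI continuous_intros)
qed

declare mult_bcontfun.rep_eq [simp]

lemma bounded_linear_mult_bcontfun:
  fixes f :: "'a::topological_space \<Rightarrow>\<^sub>C 'b::real_normed_field"
  shows "bounded_linear (mult_bcontfun f)"
proof (rule bounded_linear_intro[where K = "norm f"])
  fix x y :: "'a \<Rightarrow>\<^sub>C 'b" and r :: real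
  show "mult_bcontfun f (x + y) = mult_bcontfun f x + mult_bcontfun f y"
    by (rule bcontfun_eqI) (simp add: distrib_left)
  show "mult_bcontfun f (r *\<^sub>R x) = r *\<^sub>R mult_bcontfun f x"
    by (rule bcontfun_eqI) simp
  show "norm (mult_bcontfun f x) \<le> norm x * norm f"
    by (rule norm_bound)
      (simp add: norm_mult norm_bounded mult.commute mult_mono)
qed

lift_definition multiplication_operator ::
  "('a::topological_space \<Rightarrow>\<^sub>C 'b::real_normed_field) \<Rightarrow> ('a \<Rightarrow>\<^sub>C 'b) \<Rightarrow>\<^sub>L ('a \<Rightarrow>\<^sub>C 'b)"
  is mult_bcontfun
  by (rule bounded_linear_mult_bcontfun)

declare multiplication_operator.rep_eq [simp]

definition scale_operator ::
  "'b \<Rightarrow> (('a::topological_space \<Rightarrow>\<^sub>C 'b::real_normed_field) \<Rightarrow>\<^sub>L ('a \<Rightarrow>\<^sub>C 'b))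
     \<Rightarrow> (('a \<Rightarrow>\<^sub>C 'b) \<Rightarrow>\<^sub>L ('a \<Rightarrow>\<^sub>C 'b))"
  where "scale_operator c T = multiplication_operator (const_bcontfun c) o\<^sub>L T"

text \<open>
  The type \<open>\<Rightarrow>\<^sub>L\<close> only guarantees linearity over the reals. Linearity over \<open>'b\<close> has
  to be required separately; it is automatic for \<open>'b = real\<close>.
\<close>

definition scalar_linear_operators ::
  "(('a::topological_space \<Rightarrow>\<^sub>C 'b::real_normed_field) \<Rightarrow>\<^sub>L ('a \<Rightarrow>\<^sub>C 'b)) set"
  where "scalar_linear_operators =
    {T. \<forall>c x. blinfun_apply T (mult_bcontfun (const_bcontfun c) x) =
              mult_bcontfun (const_bcontfun c) (blinfun_apply T x)}"

definition commutant ::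
  "(('a::topological_space \<Rightarrow>\<^sub>C 'b::real_normed_field) \<Rightarrow>\<^sub>L ('a \<Rightarrow>\<^sub>C 'b)) set
     \<Rightarrow> (('a \<Rightarrow>\<^sub>C 'b) \<Rightarrow>\<^sub>L ('a \<Rightarrow>\<^sub>C 'b)) set"
  where "commutant S = {T \<in> scalar_linear_operators. \<forall>A\<in>S. T o\<^sub>L A = A o\<^sub>L T}"

definition double_commutant ::
  "(('a::topological_space \<Rightarrow>\<^sub>C 'b::real_normed_field) \<Rightarrow>\<^sub>L ('a \<Rightarrow>\<^sub>C 'b)) set
     \<Rightarrow> (('a \<Rightarrow>\<^sub>C 'b) \<Rightarrow>\<^sub>L ('a \<Rightarrow>\<^sub>C 'b)) set"
  where "double_commutant S = commutant (commutant S)"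

inductive_set unital_algebra_generated ::
  "(('a::topological_space \<Rightarrow>\<^sub>C 'b::real_normed_field) \<Rightarrow>\<^sub>L ('a \<Rightarrow>\<^sub>C 'b)) set
     \<Rightarrow> (('a \<Rightarrow>\<^sub>C 'b) \<Rightarrow>\<^sub>L ('a \<Rightarrow>\<^sub>C 'b)) set"
  for S
  where
    generator: "T \<in> S \<Longrightarrow> T \<in> unital_algebra_generated S"
  | identity: "id_blinfun \<in> unital_algebra_generated S"
  | add: "T \<in> unital_algebra_generated S \<Longrightarrow> U \<in> unital_algebra_generated S
          \<Longrightarrow> T + U \<in> unital_algebra_generated S"
  | scale: "T \<in> unital_algebra_generated S \<Longrightarrow> scale_operator c T \<in> unital_algebra_generated S"
  | compose: "T \<in> unital_algebra_generated S \<Longrightarrow> U \<in> unital_algebra_generated S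
          \<Longrightarrow> T o\<^sub>L U \<in> unital_algebra_generated S"

text \<open>The closure below is taken in the norm of \<open>\<Rightarrow>\<^sub>L\<close>, which is the operator norm.\<close>

definition double_commutant_property_over ::
  "'a::topological_space itself \<Rightarrow> 'b::real_normed_field itself \<Rightarrow> bool"
  where "double_commutant_property_over TA TB \<longleftrightarrow>
    (\<forall>f :: 'a \<Rightarrow>\<^sub>C 'b. (\<forall>t. apply_bcontfun f t \<in> \<real>) \<longrightarrow>
       double_commutant {multiplication_operator f} =
       closure (unital_algebra_generated {multiplication_operator f}))"

definition DCP :: "'a::topological_space itself \<Rightarrow> bool"
  where "DCP TA \<longleftrightarrow>
    double_commutant_property_over TA TYPE(real) \<and>
    double_commutant_property_over TA TYPE(complex)"

end

theory Submission
  imports Defs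
begin

text \<open>
  Let \<open>f\<close> be real-valued, \<open>\<phi>\<close> the same function with values in the type \<open>real\<close>, and \<open>F\<close> the
  multiplication operator of \<open>f\<close>. An operator \<open>G\<close> in the double commutant of \<open>F\<close> commutes with all
  multiplication operators, hence is itself multiplication by \<open>g = G 1\<close>. If \<open>g\<close> is constant on
  every fibre of \<open>\<phi>\<close>, then compactness gives \<open>g = h \<circ> \<phi>\<close> with \<open>h\<close> continuous on the range of
  \<open>\<phi>\<close>, and the Weierstrass theorem makes \<open>G\<close> a norm limit of polynomials in \<open>F\<close>. So everything
  rests on producing enough operators commuting with \<open>F\<close> to force \<open>g\<close> to be constant on fibres.

  If the fibre over \<open>r\<close> has interior, take \<open>(T x) u = w u * x s\<close> with a bump function \<open>w\<close>
  living inside the fibre and \<open>s\<close> any point of the fibre; commuting with \<open>T\<close> says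
  \<open>g t = g s\<close> where \<open>w t = 1\<close> (\<open>constant_on_plateau\<close>).

  If no fibre over an open interval has interior, look at one of the sets \<open>C\<close> of the exhaustion
  whose values run across that interval. The points of \<open>C\<close> at which \<open>\<phi>\<close> takes values on both
  sides of its value \<open>r\<close> in every neighbourhood form a nonempty set \<open>A r\<close>, and the map \<open>A\<close> is lower
  semicontinuous because \<open>C\<close> is locally connected. As in Michael's selection theorem, this
  yields probability measures on the fibres, depending continuously on \<open>r\<close>: start with the whole
  of \<open>C\<close>, repeatedly replace each piece by finitely many smaller pieces with a partition of unity
  on the value line, and pass to the uniform limit of the resulting weighted point evaluations. The
  limit \<open>\<Lambda>\<close> (\<open>averaging_functional\<close>) turns \<open>x\<close> into a function of the value \<open>r\<close>, and
  \<open>(T x) u = \<Lambda> x (\<phi> u)\<close> commutes with \<open>F\<close>. Commuting with \<open>T\<close> then gives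
  \<open>g u = \<Lambda> g (\<phi> u)\<close> where \<open>\<Lambda> 1 (\<phi> u) = 1\<close>, so \<open>g\<close> is constant on these fibres over the
  whole space.

  The values with constant fibres are therefore dense in the range of \<open>\<phi>\<close>. For any other value
  \<open>r\<close> the points of the fibre inside \<open>C\<close> are limits of points with values above \<open>r\<close> or of points
  with values below \<open>r\<close>. Two points approached from the same side have equal \<open>g\<close>, because both
  see the same good values nearby, and connectedness of \<open>C\<close> links the two sides
  (\<open>equal_on_fibre_within\<close>). Density of the union \<open>U\<close> of the exhaustion carries the result to
  all fibres over \<open>\<phi> ` U\<close>. A value missed by \<open>\<phi> ` U\<close> is an endpoint of the range; there a
  path into \<open>U\<close> shows that \<open>g\<close> has a limit as the value of \<open>\<phi>\<close> tends to that endpoint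
  (\<open>fibre_value_from_path\<close>).
\<close>

section \<open>Compact metrizable spaces\<close>

text \<open>
  The type carries only a topology. Fixing a compatible metric gives a notion of small set that is
  uniform over the whole space and serves all continuous functions at once.
\<close>

locale metrized_compactum = Metric_space "UNIV :: 'a::topological_space set" d for d +
  assumes mtopology_eq: "mtopology = (euclidean :: 'a topology)"
    and compact_UNIV: "compact (UNIV :: 'a set)"
begin

definition small :: "nat \<Rightarrow> 'a set \<Rightarrow> bool" where
  "small n V \<longleftrightarrow> (\<forall>u\<in>V. \<forall>v\<in>V. d u v < inverse (real (Suc n)))"

lemma small_subset: "small n V \<Longrightarrow> W \<subseteq> V \<Longrightarrow> small n W"
  unfolding small_def by blast

lemma open_mball: "open (mball s e)"
  using openin_mball[of s e] by (simp add: mtopology_eq)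

lemma small_neighbourhood:
  obtains W where "open W" "s \<in> W" "small n W"
proof (rule that)
  let ?e = "inverse (real (Suc n)) / 2"
  show "open (mball s ?e)" by (rule open_mball)
  show "s \<in> mball s ?e" by simp
  show "small n (mball s ?e)"
    unfolding small_def
  proof (intro ballI)
    fix u v assume "u \<in> mball s ?e" "v \<in> mball s ?e"
    then have "d s u < ?e" "d s v < ?e" by auto
    moreover have "d u v \<le> d s u + d s v" using triangle[of u s v] by (simp add: commute)
    ultimately show "d u v < inverse (real (Suc n))" by linarith
  qed
qed

lemma oscillation_on_small:
  fixes x :: "'a \<Rightarrow> 'c::metric_space"
  assumes "continuous_on UNIV x" "0 < \<eta>"
  obtains N where "\<And>n V u v. N \<le> n \<Longrightarrow> small n V \<Longrightarrow> u \<in> V \<Longrightarrow> v \<in> V \<Longrightarrow> dist (x u) (x v) < \<eta>"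
proof -
  interpret Q: Metric_space "UNIV :: 'c set" dist
    by unfold_locales (auto simp: dist_commute dist_triangle)
  have compact: "compact_space (mtopology_of (metric (UNIV, d)))"
    using compact_UNIV by (simp add: mtopology_eq compact_space_def)
  have cont: "continuous_map (mtopology_of (metric (UNIV, d))) (mtopology_of (metric (UNIV, dist))) x"
    using assms(1) by (simp add: mtopology_eq)
  have "uniformly_continuous_map (metric (UNIV, d)) (metric (UNIV, dist)) x"
    by (rule continuous_imp_uniformly_continuous_map[OF conjI[OF compact cont]])
  then obtain \<delta> where "\<delta> > 0" and \<delta>: "\<And>u v. d u v < \<delta> \<Longrightarrow> dist (x u) (x v) < \<eta>"
    using assms(2) unfolding uniformly_continuous_map_def by auto
  obtain N where N: "inverse (real (Suc N)) < \<delta>"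
    using reals_Archimedean[OF \<open>\<delta> > 0\<close>] by auto
  show thesis
  proof (rule that[of N])
    fix n V u v assume "N \<le> n" "small n V" "u \<in> V" "v \<in> V"
    then have "d u v < inverse (real (Suc n))" by (auto simp: small_def)
    also have "\<dots> \<le> inverse (real (Suc N))"
      using \<open>N \<le> n\<close> by (simp add: le_imp_inverse_le)
    finally show "dist (x u) (x v) < \<eta>" using N \<delta> by simp
  qed
qed

lemma bump_function:
  assumes "open W" "s \<in> W"
  obtains w :: "'a \<Rightarrow> real" where "continuous_on UNIV w" "\<And>u. 0 \<le> w u" "\<And>u. w u \<le> 1" "w s = 1"
    "\<And>u. w u \<noteq> 0 \<Longrightarrow> u \<in> W"
proof -
  have "openin mtopology W" using assms by (simp add: mtopology_eq)
  then obtain e where e: "e > 0" "mball s e \<subseteq> W"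
    using assms(2) unfolding openin_mtopology by blast
  have "continuous_map euclidean euclidean (\<lambda>u. mdist (metric (UNIV, d)) s u)"
    by (rule continuous_map_mdist) (auto simp: mtopology_eq)
  then have c: "continuous_on UNIV (d s)" by simp
  show thesis
  proof (rule that[of "\<lambda>u. max 0 (1 - d s u / e)"])
    show "continuous_on UNIV (\<lambda>u. max 0 (1 - d s u / e))"
      using e by (intro continuous_intros c) auto
    show "u \<in> W" if "max 0 (1 - d s u / e) \<noteq> 0" for u
      using that e by (auto simp: max_def divide_simps split: if_splits)
  qed (use e in auto)
qed

end

lemma metrizable_compactum_metrized:
  assumes "metrizable_space (euclidean :: 'a::topological_space topology)" "compact (UNIV :: 'a set)"
  obtains d where "metrized_compactum (d :: 'a \<Rightarrow> 'a \<Rightarrow> real)"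
proof -
  from assms(1) obtain M and d :: "'a \<Rightarrow> 'a \<Rightarrow> real"
    where "Metric_space M d" and eq: "(euclidean :: 'a topology) = Metric_space.mtopology M d"
    unfolding metrizable_space_def by blast
  moreover have "M = UNIV"
    using Metric_space.topspace_mtopology[OF \<open>Metric_space M d\<close>] eq[symmetric] by simp
  ultimately show thesis
    using assms(2) that[of d] unfolding metrized_compactum_def metrized_compactum_axioms_def by simp
qed

section \<open>Points where a function crosses a value\<close>

lemma openin_subset_closure_interior:
  assumes "openin (top_of_set C) V" "C \<subseteq> closure (interior C)"
  shows "V \<subseteq> closure (interior V)"
proof -
  obtain W where W: "open W" "V = C \<inter> W" using assms(1) by (auto simp: openin_open)
  have "V \<subseteq> W \<inter> closure (interior C)" using W assms(2) by auto
  also have "\<dots> \<subseteq> closure (W \<inter> interior C)" by (rule open_Int_closure_subset[OF W(1)])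
  also have "W \<inter> interior C \<subseteq> interior V"
    by (rule interior_maximal) (use W interior_subset[of C] in auto)
  then have "closure (W \<inter> interior C) \<subseteq> closure (interior V)" by (rule closure_mono)
  finally show ?thesis .
qed

lemma value_on_closure:
  fixes \<phi> :: "'a::topological_space \<Rightarrow> real"
  assumes "continuous_on UNIV \<phi>"
  shows "s \<in> closure (V \<inter> {u. \<phi> u < r}) \<Longrightarrow> \<phi> s \<le> r"
    and "s \<in> closure (V \<inter> {u. r < \<phi> u}) \<Longrightarrow> r \<le> \<phi> s"
proof -
  have "closed {u. \<phi> u \<le> r}" "closed {u. r \<le> \<phi> u}"
    by (intro closed_Collect_le continuous_on_const assms)+
  then have "closure (V \<inter> {u. \<phi> u < r}) \<subseteq> {u. \<phi> u \<le> r}" "closure (V \<inter> {u. r < \<phi> u}) \<subseteq> {u. r \<le> \<phi> u}"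
    by (intro closure_minimal; force)+
  then show "s \<in> closure (V \<inter> {u. \<phi> u < r}) \<Longrightarrow> \<phi> s \<le> r"
    "s \<in> closure (V \<inter> {u. r < \<phi> u}) \<Longrightarrow> r \<le> \<phi> s" by blast+
qed

text \<open>
  A point of \<open>V\<close> that is not a limit of values strictly below \<open>r\<close> or strictly above \<open>r\<close> has a
  neighbourhood in \<open>V\<close> on which \<open>\<phi>\<close> equals \<open>r\<close>; as \<open>V\<close> lies in the closure of
  its interior, this neighbourhood would contain a nonempty open set inside the fibre.
\<close>

lemma covered_by_both_sides:
  fixes \<phi> :: "'a::topological_space \<Rightarrow> real"
  assumes V: "V \<subseteq> closure (interior V)" and flat: "interior (\<phi> -` {r}) = {}"
  shows "V \<subseteq> closure (V \<inter> {u. \<phi> u < r}) \<union> closure (V \<inter> {u. r < \<phi> u})" (is "V \<subseteq> ?N \<union> ?P")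
proof
  fix v assume "v \<in> V"
  show "v \<in> ?N \<union> ?P"
  proof (rule ccontr)
    assume "v \<notin> ?N \<union> ?P"
    then have "v \<in> - (?N \<union> ?P) \<inter> closure (interior V)" using \<open>v \<in> V\<close> V by blast
    moreover have o: "open (- (?N \<union> ?P))" by (auto intro: open_Compl)
    ultimately have ne: "- (?N \<union> ?P) \<inter> interior V \<noteq> {}"
      using open_Int_closure_eq_empty[OF o] by blast
    have "- (?N \<union> ?P) \<inter> interior V \<subseteq> \<phi> -` {r}"
    proof
      fix u assume u: "u \<in> - (?N \<union> ?P) \<inter> interior V"
      then have "u \<in> V" using interior_subset[of V] by blast
      moreover have "u \<notin> V \<inter> {u. \<phi> u < r}" "u \<notin> V \<inter> {u. r < \<phi> u}"
        using u closure_subset[of "V \<inter> {u. \<phi> u < r}"] closure_subset[of "V \<inter> {u. r < \<phi> u}"]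
        by blast+
      ultimately show "u \<in> \<phi> -` {r}" by auto
    qed
    moreover have "open (- (?N \<union> ?P) \<inter> interior V)" using o by (intro open_Int) auto
    ultimately have "- (?N \<union> ?P) \<inter> interior V \<subseteq> interior (\<phi> -` {r})"
      by (rule interior_maximal)
    then show False using ne flat by blast
  qed
qed

text \<open>
  The closures of the two sides cover the connected set \<open>V\<close>, so they meet inside \<open>V\<close>. A meeting
  point is one where \<open>\<phi>\<close> has no local extremum relative to \<open>V\<close>.
\<close>

lemma balanced_point:
  fixes \<phi> :: "'a::topological_space \<Rightarrow> real"
  assumes cont: "continuous_on UNIV \<phi>"
    and V: "connected V" "V \<subseteq> closure (interior V)"
    and flat: "interior (\<phi> -` {r}) = {}"
    and t: "t \<in> V" "\<phi> t < r" "t' \<in> V" "r < \<phi> t'"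
  obtains s where "s \<in> V" "\<phi> s = r"
    "s \<in> closure (V \<inter> {u. \<phi> u < r})" "s \<in> closure (V \<inter> {u. r < \<phi> u})"
proof -
  let ?N = "closure (V \<inter> {u. \<phi> u < r})" and ?P = "closure (V \<inter> {u. r < \<phi> u})"
  have "t \<in> ?N \<inter> V" "t' \<in> ?P \<inter> V"
    using t closure_subset[of "V \<inter> {u. \<phi> u < r}"] closure_subset[of "V \<inter> {u. r < \<phi> u}"] by blast+
  then obtain s where s: "s \<in> ?N" "s \<in> ?P" "s \<in> V"
    using connected_closedD[OF V(1), of ?N ?P] covered_by_both_sides[OF V(2) flat] closed_closure
    by blast
  have "\<phi> s = r" using value_on_closure[OF cont, of s V r] s by simp
  with s that show thesis by blast
qed

section \<open>Averaging along the fibres of a real function\<close>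

locale level_crossing = metrized_compactum d
  for d :: "'a::topological_space \<Rightarrow> 'a \<Rightarrow> real" +
  fixes \<phi> :: "'a \<Rightarrow> real" and C :: "'a set" and \<alpha> \<beta> :: real
  assumes cont: "continuous_on UNIV \<phi>"
    and locally_connected: "locally connected C"
    and regular: "C \<subseteq> closure (interior C)"
    and no_plateau: "\<And>r. \<alpha> < r \<Longrightarrow> r < \<beta> \<Longrightarrow> interior (\<phi> -` {r}) = {}"
begin

text \<open>
  A pair consists of a weight on the value line and a piece of \<open>C\<close>. The values of \<open>\<phi>\<close> on the piece
  run beyond both ends of an interval carrying the weight. The strict inequalities give every value
  of positive weight a balanced point inside the piece, which is what the next subdivision needs.
\<close>

definition crossed_support :: "(real \<Rightarrow> real) \<times> 'a set \<Rightarrow> bool" where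
  "crossed_support p \<longleftrightarrow> openin (top_of_set C) (snd p) \<and> connected (snd p) \<and>
     continuous_on UNIV (fst p) \<and> (\<forall>r. 0 \<le> fst p r) \<and>
     (\<exists>a b. (\<forall>r. fst p r \<noteq> 0 \<longrightarrow> a \<le> r \<and> r \<le> b) \<and> \<alpha> < a \<and> b < \<beta> \<and>
        (\<exists>t\<in>snd p. \<phi> t < a) \<and> (\<exists>t\<in>snd p. b < \<phi> t))"

text \<open>
  Around a balanced point, an arbitrarily small connected piece still has values on both sides of
  \<open>r\<close>. This is the lower semicontinuity of the set of balanced points, and the only place where
  local connectedness of \<open>C\<close> enters the construction of the averages.
\<close>

lemma small_crossing:
  assumes V: "openin (top_of_set C) V" "connected V"
    and r: "\<alpha> < r" "r < \<beta>" and t: "t \<in> V" "\<phi> t < r" "t' \<in> V" "r < \<phi> t'"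
  shows "\<exists>W lo hi. openin (top_of_set C) W \<and> connected W \<and> W \<subseteq> V \<and> small n W \<and>
     lo < r \<and> r < hi \<and> \<alpha> < lo \<and> hi < \<beta> \<and> (\<exists>u\<in>W. \<phi> u < lo) \<and> (\<exists>u\<in>W. hi < \<phi> u)"
proof -
  obtain s where s: "s \<in> V" "\<phi> s = r"
      "s \<in> closure (V \<inter> {u. \<phi> u < r})" "s \<in> closure (V \<inter> {u. r < \<phi> u})"
    using balanced_point[OF cont V(2) openin_subset_closure_interior[OF V(1) regular]
        no_plateau[OF r] t] by blast
  obtain N where N: "open N" "s \<in> N" "small n N" by (rule small_neighbourhood)
  have "openin (top_of_set C) (V \<inter> N)" using V(1) N(1) by (auto simp: openin_open)
  then obtain W where W: "openin (top_of_set C) W" "connected W" "s \<in> W" "W \<subseteq> V \<inter> N"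
    using locally_connected s(1) N(2) unfolding Homotopy.locally_connected by blast
  obtain O' where O': "open O'" "W = C \<inter> O'" using W(1) by (auto simp: openin_open)
  have "V \<subseteq> C" using V(1) openin_imp_subset by blast
  have "s \<in> O'" using W(3) O'(2) by blast
  then obtain u where u: "u \<in> W" "\<phi> u < r"
    using s(3) O' \<open>V \<subseteq> C\<close> unfolding closure_iff_nhds_not_empty by blast
  obtain u' where u': "u' \<in> W" "r < \<phi> u'"
    using \<open>s \<in> O'\<close> s(4) O' \<open>V \<subseteq> C\<close> unfolding closure_iff_nhds_not_empty by blast
  obtain lo where lo: "max \<alpha> (\<phi> u) < lo" "lo < r" using dense[of "max \<alpha> (\<phi> u)" r] u r by auto
  obtain hi where hi: "r < hi" "hi < min \<beta> (\<phi> u')" using dense[of r "min \<beta> (\<phi> u')"] u' r by auto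
  have "small n W" using W(4) N(3) by (blast intro: small_subset)
  with W u u' lo hi show ?thesis by (intro exI[of _ W] exI[of _ lo] exI[of _ hi]) auto
qed

text \<open>
  Finitely many of the small crossings cover the compact interval carrying the weight; the
  weight is distributed among them by a partition of unity.
\<close>

lemma split_crossed_support:
  assumes "crossed_support p"
  shows "\<exists>D. (\<forall>q\<in>set D. crossed_support q \<and> snd q \<subseteq> snd p \<and> small n (snd q)) \<and>
     (\<forall>r. (\<Sum>q\<leftarrow>D. fst q r) = fst p r)"
proof -
  let ?e = "fst p" and ?V = "snd p"
  from assms obtain a b t t' where V: "openin (top_of_set C) ?V" "connected ?V"
    and e: "continuous_on UNIV ?e" "\<And>r. 0 \<le> ?e r" "\<And>r. ?e r \<noteq> 0 \<Longrightarrow> a \<le> r \<and> r \<le> b"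
    and ab: "\<alpha> < a" "b < \<beta>" and t: "t \<in> ?V" "\<phi> t < a" "t' \<in> ?V" "b < \<phi> t'"
    unfolding crossed_support_def by blast
  have "\<forall>r\<in>{a..b}. \<exists>W lo hi. openin (top_of_set C) W \<and> connected W \<and> W \<subseteq> ?V \<and> small n W \<and>
     lo < r \<and> r < hi \<and> \<alpha> < lo \<and> hi < \<beta> \<and> (\<exists>u\<in>W. \<phi> u < lo) \<and> (\<exists>u\<in>W. hi < \<phi> u)"
    by (intro ballI small_crossing[OF V _ _ t(1) _ t(3)]) (use ab t in auto)
  then obtain W lo hi where W: "\<And>r. r \<in> {a..b} \<Longrightarrow> openin (top_of_set C) (W r) \<and> connected (W r)
     \<and> W r \<subseteq> ?V \<and> small n (W r) \<and> lo r < r \<and> r < hi r \<and> \<alpha> < lo r \<and> hi r < \<beta> \<and>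
     (\<exists>u\<in>W r. \<phi> u < lo r) \<and> (\<exists>u\<in>W r. hi r < \<phi> u)"
    by metis
  have "{a..b} \<subseteq> (\<Union>r\<in>{a..b}. {lo r<..<hi r})" using W by fastforce
  then obtain R where R: "R \<subseteq> {a..b}" "finite R" "{a..b} \<subseteq> (\<Union>r\<in>R. {lo r<..<hi r})"
    by (rule compactE_image[OF compact_Icc, rotated]) auto
  obtain rs where rs: "set rs = R" "distinct rs" using finite_distinct_list[OF R(2)] by blast
  (* tents over the chosen intervals; the extra summand of the normalising factor vanishes on
     {a..b}, and keeps it positive outside, so that the quotients are continuous on all reals *)
  define \<rho> where "\<rho> r x = max 0 (min (x - lo r) (hi r - x))" for r x
  define den where "den x = (\<Sum>r\<in>R. \<rho> r x) + max 0 (max (a - x) (x - b))" for x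
  have \<rho>_nonneg: "0 \<le> \<rho> r x" for r x by (simp add: \<rho>_def)
  have \<rho>_pos: "0 < \<rho> r x \<longleftrightarrow> lo r < x \<and> x < hi r" for r x by (auto simp: \<rho>_def)
  have den_pos: "0 < den x" for x
  proof (cases "x \<in> {a..b}")
    case True
    then obtain r where "r \<in> R" "0 < \<rho> r x" using R(3) \<rho>_pos by force
    then have "0 < (\<Sum>r\<in>R. \<rho> r x)" using R(2) \<rho>_nonneg by (intro sum_pos2[of R r]) auto
    then show ?thesis by (simp add: den_def add_pos_nonneg)
  next
    case False
    then have "0 < max 0 (max (a - x) (x - b))" by auto
    then show ?thesis unfolding den_def by (intro add_nonneg_pos sum_nonneg \<rho>_nonneg)
  qed
  have cont_\<rho>: "continuous_on UNIV (\<rho> r)" for r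
    unfolding \<rho>_def by (intro continuous_intros)
  have cont_den: "continuous_on UNIV den"
    unfolding den_def by (intro continuous_intros cont_\<rho>)
  define D where "D = map (\<lambda>r. (\<lambda>x. ?e x * (\<rho> r x / den x), W r)) rs"
  have "crossed_support q \<and> snd q \<subseteq> ?V \<and> small n (snd q)" if q: "q \<in> set D" for q
  proof -
    obtain r where r: "r \<in> {a..b}" "q = (\<lambda>x. ?e x * (\<rho> r x / den x), W r)"
      using q rs R(1) by (auto simp: D_def)
    have supp: "fst q x \<noteq> 0 \<Longrightarrow> lo r \<le> x \<and> x \<le> hi r" for x
      using \<rho>_pos[of r x] \<rho>_nonneg[of r x] by (auto simp: r(2) less_le)
    have c: "continuous_on UNIV (fst q)"
      unfolding r(2) fst_conv
      by (intro continuous_on_mult continuous_on_divide e cont_\<rho> cont_den)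
         (use den_pos in \<open>auto simp: less_le\<close>)
    have "0 \<le> fst q x" for x
      using e(2)[of x] \<rho>_nonneg[of r x] den_pos[of x] by (simp add: r(2))
    with c supp W[OF r(1)] show ?thesis
      unfolding crossed_support_def by (auto simp: r(2))
  qed
  moreover have "(\<Sum>q\<leftarrow>D. fst q x) = ?e x" for x
  proof -
    have "(\<Sum>q\<leftarrow>D. fst q x) = (\<Sum>r\<in>R. ?e x * (\<rho> r x / den x))"
      using rs by (simp add: D_def comp_def sum_list_distinct_conv_sum_set)
    also have "\<dots> = ?e x * ((\<Sum>r\<in>R. \<rho> r x) / den x)"
      by (simp add: sum_distrib_left sum_divide_distrib)
    also have "\<dots> = ?e x"
    proof (cases "?e x = 0")
      case False
      then have "den x = (\<Sum>r\<in>R. \<rho> r x)" using e(3)[of x] by (simp add: den_def)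
      then show ?thesis using den_pos[of x] by simp
    qed simp
    finally show ?thesis .
  qed
  ultimately show ?thesis by blast
qed

end

text \<open>
  Each piece is represented by an arbitrary one of its points; as the pieces shrink, the choice
  ceases to matter for continuous functions.
\<close>

definition average :: "((real \<Rightarrow> real) \<times> 'a set) list \<Rightarrow> ('a \<Rightarrow> 'b::real_normed_vector) \<Rightarrow> real \<Rightarrow> 'b" where
  "average D x r = (\<Sum>p\<leftarrow>D. fst p r *\<^sub>R x (SOME v. v \<in> snd p))"

text \<open>
  The function \<open>h\<close> groups the finer family by the pieces that it subdivides. A grouping is needed
  rather than a mere inclusion of pieces, because the weights have to add up within each group.
\<close>

definition refines :: "((real \<Rightarrow> real) \<times> 'a set) list \<Rightarrow> ((real \<Rightarrow> real) \<times> 'a set) list \<Rightarrow> bool" where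
  "refines D' D \<longleftrightarrow> (\<exists>h. D' = concat (map h D) \<and>
     (\<forall>p\<in>set D. (\<forall>q\<in>set (h p). snd q \<noteq> {} \<and> snd q \<subseteq> snd p \<and> (\<forall>r. 0 \<le> fst q r)) \<and>
        (\<forall>r. (\<Sum>q\<leftarrow>h p. fst q r) = fst p r)))"

lemma sum_list_concat_map: "(\<Sum>q\<leftarrow>concat (map h D). f q) = (\<Sum>p\<leftarrow>D. \<Sum>q\<leftarrow>h p. f q)"
  for f :: "'c \<Rightarrow> 'd::comm_monoid_add"
  by (induction D) auto

lemma sum_list_scaleR_left: "(\<Sum>p\<leftarrow>D. f p) *\<^sub>R a = (\<Sum>p\<leftarrow>D. f p *\<^sub>R a)"
  for a :: "'d::real_vector"
  by (induction D) (auto simp: scaleR_add_left)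

lemma norm_sum_list_le:
  fixes f :: "'c \<Rightarrow> 'd::real_normed_vector"
  shows "(\<And>p. p \<in> set D \<Longrightarrow> norm (f p) \<le> w p) \<Longrightarrow> norm (\<Sum>p\<leftarrow>D. f p) \<le> (\<Sum>p\<leftarrow>D. w p)"
  by (induction D) (auto intro: order_trans[OF norm_triangle_ineq] add_mono)

lemma refines_refl:
  assumes "\<And>p. p \<in> set D \<Longrightarrow> snd p \<noteq> {} \<and> (\<forall>r. 0 \<le> fst p r)"
  shows "refines D D"
  unfolding refines_def by (rule exI[of _ "\<lambda>p. [p]"]) (use assms in auto)

lemma refines_trans:
  assumes "refines D'' D'" "refines D' D"
  shows "refines D'' D"
proof -
  from assms(2) obtain h where h: "D' = concat (map h D)"
    "\<And>p q. p \<in> set D \<Longrightarrow> q \<in> set (h p) \<Longrightarrow> snd q \<subseteq> snd p"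
    "\<And>p r. p \<in> set D \<Longrightarrow> (\<Sum>q\<leftarrow>h p. fst q r) = fst p r"
    unfolding refines_def by blast
  from assms(1) obtain k where k: "D'' = concat (map k D')"
    "\<And>p q. p \<in> set D' \<Longrightarrow> q \<in> set (k p) \<Longrightarrow> snd q \<noteq> {} \<and> snd q \<subseteq> snd p \<and> (\<forall>r. 0 \<le> fst q r)"
    "\<And>p r. p \<in> set D' \<Longrightarrow> (\<Sum>q\<leftarrow>k p. fst q r) = fst p r"
    unfolding refines_def by blast
  let ?l = "\<lambda>p. concat (map k (h p))"
  have "D'' = concat (map ?l D)" unfolding k(1) h(1) by (induction D) auto
  moreover have "snd q \<noteq> {} \<and> snd q \<subseteq> snd p \<and> (\<forall>r. 0 \<le> fst q r)"
    if p: "p \<in> set D" and q: "q \<in> set (?l p)" for p q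
  proof -
    obtain p' where p': "p' \<in> set (h p)" "q \<in> set (k p')" using q by auto
    then have "p' \<in> set D'" using p by (auto simp: h(1))
    then show ?thesis using k(2)[OF _ p'(2)] h(2)[OF p p'(1)] by blast
  qed
  moreover have "(\<Sum>q\<leftarrow>?l p. fst q r) = fst p r" if p: "p \<in> set D" for p r
  proof -
    have "(\<Sum>p'\<leftarrow>h p. \<Sum>q\<leftarrow>k p'. fst q r) = (\<Sum>p'\<leftarrow>h p. fst p' r)"
      using p by (intro arg_cong[of _ _ sum_list] map_cong refl k(3)) (auto simp: h(1))
    then show ?thesis unfolding sum_list_concat_map h(3)[OF p] .
  qed
  ultimately show ?thesis unfolding refines_def by (intro exI[of _ ?l]) blast
qed

text \<open>
  Subdividing moves the weight of a piece only to points of the same piece, so the average changes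
  by at most the oscillation on the pieces of the coarser family, however fine the other one is.
\<close>

lemma average_refines:
  fixes x :: "'a \<Rightarrow> 'b::real_normed_vector"
  assumes ref: "refines D' D"
    and ne: "\<And>p. p \<in> set D \<Longrightarrow> snd p \<noteq> {}"
    and osc: "\<And>p u v. p \<in> set D \<Longrightarrow> u \<in> snd p \<Longrightarrow> v \<in> snd p \<Longrightarrow> norm (x u - x v) \<le> \<eta>"
  shows "norm (average D' x r - average D x r) \<le> \<eta> * (\<Sum>p\<leftarrow>D. fst p r)"
proof -
  let ?pt = "\<lambda>p :: (real \<Rightarrow> real) \<times> 'a set. SOME v. v \<in> snd p"
  from ref obtain h where h: "D' = concat (map h D)"
    "\<And>p q. p \<in> set D \<Longrightarrow> q \<in> set (h p) \<Longrightarrow> snd q \<noteq> {} \<and> snd q \<subseteq> snd p \<and> (\<forall>r. 0 \<le> fst q r)"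
    "\<And>p r. p \<in> set D \<Longrightarrow> (\<Sum>q\<leftarrow>h p. fst q r) = fst p r"
    unfolding refines_def by blast
  have pt: "?pt p \<in> snd p" if "snd p \<noteq> {}" for p :: "(real \<Rightarrow> real) \<times> 'a set"
    using that by (simp add: some_in_eq)
  have piece: "norm ((\<Sum>q\<leftarrow>h p. fst q r *\<^sub>R x (?pt q)) - fst p r *\<^sub>R x (?pt p)) \<le> \<eta> * fst p r"
    if p: "p \<in> set D" for p
  proof -
    have "(\<Sum>q\<leftarrow>h p. fst q r *\<^sub>R x (?pt q)) - fst p r *\<^sub>R x (?pt p)
        = (\<Sum>q\<leftarrow>h p. fst q r *\<^sub>R (x (?pt q) - x (?pt p)))"
      unfolding h(3)[OF p, symmetric]
      by (simp add: scaleR_diff_right sum_list_subtractf sum_list_scaleR_left)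
    also have "norm \<dots> \<le> (\<Sum>q\<leftarrow>h p. \<eta> * fst q r)"
    proof (rule norm_sum_list_le)
      fix q assume q: "q \<in> set (h p)"
      have "norm (x (?pt q) - x (?pt p)) \<le> \<eta>"
        using osc[OF p] pt[of q] pt[OF ne[OF p]] h(2)[OF p q] by blast
      then show "norm (fst q r *\<^sub>R (x (?pt q) - x (?pt p))) \<le> \<eta> * fst q r"
        using h(2)[OF p q] by (simp add: mult.commute[of \<eta>] mult_left_mono)
    qed
    also have "\<dots> = \<eta> * fst p r"
      unfolding h(3)[OF p, symmetric] by (simp add: sum_list_const_mult)
    finally show ?thesis .
  qed
  have "average D' x r - average D x r
      = (\<Sum>p\<leftarrow>D. (\<Sum>q\<leftarrow>h p. fst q r *\<^sub>R x (?pt q)) - fst p r *\<^sub>R x (?pt p))"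
    unfolding average_def h(1) sum_list_concat_map by (simp add: sum_list_subtractf)
  also have "norm \<dots> \<le> (\<Sum>p\<leftarrow>D. \<eta> * fst p r)"
    by (rule norm_sum_list_le) (rule piece)
  also have "\<dots> = \<eta> * (\<Sum>p\<leftarrow>D. fst p r)" by (simp add: sum_list_const_mult)
  finally show ?thesis .
qed

context level_crossing
begin

text \<open>
  The value \<open>\<Lambda> x r\<close> is, up to a cutoff in \<open>r\<close>, the integral of \<open>x\<close> against a probability measure
  on the fibre over \<open>r\<close> that depends continuously on \<open>r\<close>. Being carried by the fibre is expressed
  by the rule for multiplication by \<open>\<phi>\<close>, which is what makes the associated operator commute with
  the multiplication operator of \<open>\<phi>\<close>.
\<close>

theorem averaging_functional:
  assumes "connected C" and t: "t \<in> C" "\<phi> t \<le> \<alpha>" "t' \<in> C" "\<beta> \<le> \<phi> t'"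
    and r0: "\<alpha> < r\<^sub>0" "r\<^sub>0 < \<beta>"
  obtains \<Lambda> :: "('a \<Rightarrow> 'b::{real_normed_field, banach}) \<Rightarrow> real \<Rightarrow> 'b"
  where "\<And>x. continuous_on UNIV x \<Longrightarrow> continuous_on UNIV (\<Lambda> x)"
    "\<And>x y r. continuous_on UNIV x \<Longrightarrow> continuous_on UNIV y \<Longrightarrow>
       \<Lambda> (\<lambda>u. x u + y u) r = \<Lambda> x r + \<Lambda> y r"
    "\<And>x c r. continuous_on UNIV x \<Longrightarrow> \<Lambda> (\<lambda>u. c * x u) r = c * \<Lambda> x r"
    "\<And>x B r. continuous_on UNIV x \<Longrightarrow> (\<And>u. norm (x u) \<le> B) \<Longrightarrow> norm (\<Lambda> x r) \<le> B"
    "\<And>x r. continuous_on UNIV x \<Longrightarrow> \<Lambda> (\<lambda>u. of_real (\<phi> u) * x u) r = of_real r * \<Lambda> x r"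
    "\<Lambda> (\<lambda>_. 1) r\<^sub>0 = 1"
proof -
  define \<delta> where "\<delta> = min (r\<^sub>0 - \<alpha>) (\<beta> - r\<^sub>0) / 2"
  have \<delta>: "0 < \<delta>" "\<alpha> < r\<^sub>0 - \<delta>" "r\<^sub>0 + \<delta> < \<beta>" using r0 by (auto simp: \<delta>_def min_def field_simps)
  (* a tent of height 1 at the given value, supported well inside the open interval *)
  define \<psi> where "\<psi> r = max 0 (1 - \<bar>r - r\<^sub>0\<bar> / \<delta>)" for r
  have \<psi>: "0 \<le> \<psi> r" "\<psi> r \<le> 1" for r using \<delta> by (auto simp: \<psi>_def)
  have cont_\<psi>: "continuous_on UNIV \<psi>" unfolding \<psi>_def using \<delta> by (intro continuous_intros) auto
  have supp_\<psi>: "r\<^sub>0 - \<delta> \<le> r \<and> r \<le> r\<^sub>0 + \<delta>" if "\<psi> r \<noteq> 0" for r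
  proof -
    have "\<bar>r - r\<^sub>0\<bar> / \<delta> < 1" using that unfolding \<psi>_def by linarith
    then have "\<bar>r - r\<^sub>0\<bar> < \<delta>" using \<delta> by (simp add: divide_simps)
    then show ?thesis by linarith
  qed
  have start: "crossed_support (\<psi>, C)"
  proof -
    have "\<phi> t < r\<^sub>0 - \<delta>" "r\<^sub>0 + \<delta> < \<phi> t'" using t \<delta> by linarith+
    then have "\<exists>a b. (\<forall>r. \<psi> r \<noteq> 0 \<longrightarrow> a \<le> r \<and> r \<le> b) \<and> \<alpha> < a \<and> b < \<beta> \<and>
        (\<exists>t\<in>C. \<phi> t < a) \<and> (\<exists>t\<in>C. b < \<phi> t)"
      using t \<delta> supp_\<psi> by meson
    then show ?thesis
      unfolding crossed_support_def using \<open>connected C\<close> cont_\<psi> \<psi>(1) by simp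
  qed
  define split where "split n p = (SOME L. (\<forall>q\<in>set L. crossed_support q \<and> snd q \<subseteq> snd p \<and> small n (snd q)) \<and>
      (\<forall>r. (\<Sum>q\<leftarrow>L. fst q r) = fst p r))" for n p
  have split: "(\<forall>q\<in>set (split n p). crossed_support q \<and> snd q \<subseteq> snd p \<and> small n (snd q)) \<and>
      (\<forall>r. (\<Sum>q\<leftarrow>split n p. fst q r) = fst p r)" if "crossed_support p" for n p
    unfolding split_def by (rule someI_ex) (rule split_crossed_support[OF that])
  define D where "D = rec_nat [(\<psi>, C)] (\<lambda>n D. concat (map (split n) D))"
  have D_0: "D 0 = [(\<psi>, C)]" and D_Suc: "D (Suc n) = concat (map (split n) (D n))" for n
    by (simp_all add: D_def)
  have crossed: "crossed_support p" if "p \<in> set (D n)" for n p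
    using that
  proof (induction n arbitrary: p)
    case 0
    then show ?case using start by (simp add: D_0)
  next
    case (Suc n)
    then obtain p' where "p' \<in> set (D n)" "p \<in> set (split n p')" by (auto simp: D_Suc)
    then show ?case using Suc.IH split by blast
  qed
  have ne: "snd p \<noteq> {}" and nonneg: "0 \<le> fst p r" if "p \<in> set (D n)" for n p r
    using crossed[OF that] by (auto simp: crossed_support_def)
  have small_D: "small n (snd p)" if p: "p \<in> set (D (Suc n))" for n p
  proof -
    obtain p' where "p' \<in> set (D n)" "p \<in> set (split n p')" using p by (auto simp: D_Suc)
    then show ?thesis using split[OF crossed] by blast
  qed
  have step: "refines (D (Suc n)) (D n)" for n
    unfolding refines_def
  proof (intro exI[of _ "split n"] conjI ballI allI)
    fix p q assume p: "p \<in> set (D n)" and q: "q \<in> set (split n p)"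
    then have "q \<in> set (D (Suc n))" by (auto simp: D_Suc)
    then show "snd q \<noteq> {}" "\<And>r. 0 \<le> fst q r" using ne nonneg by blast+
    show "snd q \<subseteq> snd p" using split[OF crossed[OF p]] q by blast
  qed (use split[OF crossed] D_Suc in blast)+
  have refines_D: "refines (D m) (D n)" if "n \<le> m" for n m
    using that
  proof (induction rule: dec_induct)
    case base
    show ?case by (rule refines_refl) (use ne nonneg in blast)
  next
    case (step m)
    then show ?case using refines_trans \<open>\<And>n. refines (D (Suc n)) (D n)\<close> by blast
  qed
  have weights: "(\<Sum>p\<leftarrow>D n. fst p r) = \<psi> r" for n r
  proof (induction n)
    case (Suc n)
    have "(\<Sum>p\<leftarrow>D n. \<Sum>q\<leftarrow>split n p. fst q r) = (\<Sum>p\<leftarrow>D n. fst p r)"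
      using split[OF crossed] by (intro arg_cong[of _ _ sum_list] map_cong refl) blast
    then show ?case unfolding D_Suc sum_list_concat_map Suc .
  qed (simp add: D_0)
  have osc_D: "\<exists>N. \<forall>n\<ge>N. \<forall>p\<in>set (D n). \<forall>u\<in>snd p. \<forall>v\<in>snd p. dist (x u) (x v) < \<eta>"
    if x: "continuous_on UNIV x" and \<eta>: "\<eta> > 0" for x :: "'a \<Rightarrow> 'c::metric_space" and \<eta>
  proof -
    obtain N where N: "\<And>n V u v. N \<le> n \<Longrightarrow> small n V \<Longrightarrow> u \<in> V \<Longrightarrow> v \<in> V \<Longrightarrow> dist (x u) (x v) < \<eta>"
      by (rule oscillation_on_small[OF x \<eta>]) blast
    have "dist (x u) (x v) < \<eta>" if "n \<ge> Suc N" "p \<in> set (D n)" "u \<in> snd p" "v \<in> snd p" for n p u v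
    proof -
      obtain m where m: "n = Suc m" "N \<le> m" using \<open>n \<ge> Suc N\<close> by (cases n) auto
      then show ?thesis using N[OF m(2) small_D] that by blast
    qed
    then show ?thesis by blast
  qed
  have cont_average: "continuous_on UNIV (average (D n) x)" for n and x :: "'a \<Rightarrow> 'b"
  proof -
    have "continuous_on UNIV (\<lambda>r. \<Sum>p\<leftarrow>L. fst p r *\<^sub>R x (SOME v. v \<in> snd p))"
      if "\<And>p. p \<in> set L \<Longrightarrow> crossed_support p" for L :: "((real \<Rightarrow> real) \<times> 'a set) list"
      using that by (induction L) (auto intro!: continuous_intros simp: crossed_support_def)
    then show ?thesis using crossed unfolding average_def by blast
  qed
  define \<Lambda> where "\<Lambda> x r = lim (\<lambda>n. average (D n) x r)" for x :: "'a \<Rightarrow> 'b" and r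
  have unif: "uniform_limit UNIV (\<lambda>n. average (D n) x) (\<Lambda> x) sequentially"
    if x: "continuous_on UNIV x" for x :: "'a \<Rightarrow> 'b"
  proof -
    have "uniformly_Cauchy_on UNIV (\<lambda>n. average (D n) x)"
    proof (rule uniformly_Cauchy_onI)
      fix e :: real assume "e > 0"
      then obtain N where N: "\<And>p u v. p \<in> set (D N) \<Longrightarrow> u \<in> snd p \<Longrightarrow> v \<in> snd p \<Longrightarrow> dist (x u) (x v) < e/3"
        using osc_D[OF x, of "e/3"] by (metis order_refl zero_less_divide_iff zero_less_numeral)
      have *: "dist (average (D m) x r) (average (D N) x r) \<le> e/3" if "m \<ge> N" for m r
      proof -
        have "norm (average (D m) x r - average (D N) x r) \<le> e/3 * (\<Sum>p\<leftarrow>D N. fst p r)"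
          by (rule average_refines[OF refines_D[OF that] ne])
             (use N in \<open>auto simp: dist_norm less_imp_le\<close>)
        also have "\<dots> \<le> e/3 * 1" unfolding weights using \<open>e > 0\<close> \<psi> by (intro mult_left_mono) auto
        finally show ?thesis by (simp add: dist_norm)
      qed
      have "dist (average (D m) x r) (average (D n) x r) < e" if "m \<ge> N" "n \<ge> N" for m n r
        using *[OF that(1), of r] *[OF that(2), of r] \<open>e > 0\<close>
          dist_triangle2[of "average (D m) x r" "average (D n) x r" "average (D N) x r"] by linarith
      then show "\<exists>M. \<forall>r\<in>UNIV. \<forall>m\<ge>M. \<forall>n\<ge>M. dist (average (D m) x r) (average (D n) x r) < e" by blast
    qed
    then show ?thesis
      using Cauchy_uniformly_convergent uniformly_convergent_uniform_limit_iff
      unfolding \<Lambda>_def by blast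
  qed
  have lim: "(\<lambda>n. average (D n) x r) \<longlonglongrightarrow> \<Lambda> x r" if "continuous_on UNIV x" for x :: "'a \<Rightarrow> 'b" and r
    by (rule tendsto_uniform_limitI[OF unif[OF that]]) simp
  show thesis
  proof (rule that)
    show "continuous_on UNIV (\<Lambda> x)" if "continuous_on UNIV x" for x
      by (rule uniform_limit_theorem[OF _ unif[OF that]]) (simp_all add: cont_average)
  next
    fix x y :: "'a \<Rightarrow> 'b" and r assume x: "continuous_on UNIV x" and y: "continuous_on UNIV y"
    have "average (D n) (\<lambda>u. x u + y u) r = average (D n) x r + average (D n) y r" for n
      by (simp add: average_def scaleR_add_right sum_list_addf)
    then have "(\<lambda>n. average (D n) (\<lambda>u. x u + y u) r) \<longlonglongrightarrow> \<Lambda> x r + \<Lambda> y r"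
      using tendsto_add[OF lim[OF x] lim[OF y]] by simp
    then show "\<Lambda> (\<lambda>u. x u + y u) r = \<Lambda> x r + \<Lambda> y r"
      using LIMSEQ_unique lim[OF continuous_on_add[OF x y]] by blast
  next
    fix x :: "'a \<Rightarrow> 'b" and c r assume x: "continuous_on UNIV x"
    have "average (D n) (\<lambda>u. c * x u) r = c * average (D n) x r" for n
      by (simp add: average_def sum_list_const_mult[symmetric])
    then have "(\<lambda>n. average (D n) (\<lambda>u. c * x u) r) \<longlonglongrightarrow> c * \<Lambda> x r"
      using tendsto_mult_left[OF lim[OF x]] by simp
    then show "\<Lambda> (\<lambda>u. c * x u) r = c * \<Lambda> x r"
      using LIMSEQ_unique lim[OF continuous_on_mult_left[OF x]] by blast
  next
    fix x :: "'a \<Rightarrow> 'b" and B r assume x: "continuous_on UNIV x" and B: "\<And>u. norm (x u) \<le> B"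
    have "0 \<le> B" using B[of undefined] norm_ge_zero order_trans by blast
    have "norm (average (D n) x r) \<le> B" for n
    proof -
      have "norm (average (D n) x r) \<le> (\<Sum>p\<leftarrow>D n. fst p r * B)"
        unfolding average_def by (rule norm_sum_list_le) (use nonneg B in \<open>auto intro!: mult_left_mono\<close>)
      also have "\<dots> = \<psi> r * B" unfolding sum_list_mult_const weights ..
      also have "\<dots> \<le> B" using \<psi>[of r] \<open>0 \<le> B\<close> by (simp add: mult_left_le_one_le)
      finally show ?thesis .
    qed
    then show "norm (\<Lambda> x r) \<le> B"
      by (intro LIMSEQ_le_const2[OF tendsto_norm[OF lim[OF x]]]) auto
  next
    fix x :: "'a \<Rightarrow> 'b" and r assume x: "continuous_on UNIV x"
    have cont\<phi>x: "continuous_on UNIV (\<lambda>u. of_real (\<phi> u) * x u)"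
      by (intro continuous_intros x cont)
    have bx: "\<exists>B>0. \<forall>u. norm (x u) \<le> B"
      using compact_imp_bounded[OF compact_continuous_image[OF x compact_UNIV]]
      by (auto simp: bounded_pos)
    then obtain B where B: "B > 0" "\<And>u. norm (x u) \<le> B" by blast
    have "(\<lambda>n. average (D n) (\<lambda>u. of_real (\<phi> u) * x u) r - of_real r * average (D n) x r) \<longlonglongrightarrow> 0"
    proof (rule LIMSEQ_I)
      fix e :: real assume "e > 0"
      then obtain N where N: "\<And>n p u v. n \<ge> N \<Longrightarrow> p \<in> set (D n) \<Longrightarrow> u \<in> snd p \<Longrightarrow> v \<in> snd p \<Longrightarrow>
          dist (\<phi> u) (\<phi> v) < e / (2 * B)"
        using osc_D[OF cont, of "e / (2 * B)"] B(1) by (metis mult_pos_pos zero_less_divide_iff zero_less_numeral)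
      have "norm (average (D n) (\<lambda>u. of_real (\<phi> u) * x u) r - of_real r * average (D n) x r) \<le> e / 2"
        if n: "n \<ge> N" for n
      proof -
        let ?pt = "\<lambda>p :: (real \<Rightarrow> real) \<times> 'a set. SOME v. v \<in> snd p"
        have "average (D n) (\<lambda>u. of_real (\<phi> u) * x u) r - of_real r * average (D n) x r
            = (\<Sum>p\<leftarrow>D n. (fst p r * (\<phi> (?pt p) - r)) *\<^sub>R x (?pt p))"
          unfolding average_def sum_list_const_mult[symmetric] sum_list_subtractf[symmetric]
          by (simp add: scaleR_conv_of_real algebra_simps)
        also have "norm \<dots> \<le> (\<Sum>p\<leftarrow>D n. fst p r * (e / 2))"
        proof (rule norm_sum_list_le)
          fix p assume p: "p \<in> set (D n)"
          show "norm ((fst p r * (\<phi> (?pt p) - r)) *\<^sub>R x (?pt p)) \<le> fst p r * (e / 2)"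
          proof (cases "fst p r = 0")
            case False
            (* a piece with positive weight at r contains a point of the fibre over r, by
               connectedness, so phi is close to r on the whole piece *)
            then obtain u v where uv: "u \<in> snd p" "v \<in> snd p" "\<phi> u \<le> r" "r \<le> \<phi> v"
              and con: "connected (snd p)"
              using crossed[OF p] unfolding crossed_support_def by force
            have "connected (\<phi> ` snd p)"
              by (intro connected_continuous_image con continuous_on_subset[OF cont]) auto
            then have "r \<in> \<phi> ` snd p"
              using uv connectedD_interval[of "\<phi> ` snd p" "\<phi> u" "\<phi> v" r] by blast
            then obtain s where s: "s \<in> snd p" "\<phi> s = r" by blast
            have "?pt p \<in> snd p" using ne[OF p] by (simp add: some_in_eq)
            then have "\<bar>\<phi> (?pt p) - r\<bar> \<le> e / (2 * B)"
              using N[OF n p _ s(1)] s(2) by (force simp: dist_real_def)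
            then have "\<bar>\<phi> (?pt p) - r\<bar> * norm (x (?pt p)) \<le> e / (2 * B) * B"
              using B \<open>e > 0\<close> by (intro mult_mono) auto
            then have "fst p r * (\<bar>\<phi> (?pt p) - r\<bar> * norm (x (?pt p))) \<le> fst p r * (e / 2)"
              using nonneg[OF p, of r] B by (intro mult_left_mono) auto
            then show ?thesis using nonneg[OF p, of r] by (simp add: abs_mult mult.assoc)
          qed simp
        qed
        also have "\<dots> = \<psi> r * (e / 2)" unfolding sum_list_mult_const weights ..
        also have "\<dots> \<le> e / 2" using \<psi>[of r] \<open>e > 0\<close> by (simp add: mult_left_le_one_le)
        finally show ?thesis .
      qed
      then show "\<exists>N. \<forall>n\<ge>N. norm (average (D n) (\<lambda>u. of_real (\<phi> u) * x u) r
          - of_real r * average (D n) x r - 0) < e"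
        using \<open>e > 0\<close> by (intro exI[of _ N]) fastforce
    qed
    moreover have "(\<lambda>n. average (D n) (\<lambda>u. of_real (\<phi> u) * x u) r - of_real r * average (D n) x r)
        \<longlonglongrightarrow> \<Lambda> (\<lambda>u. of_real (\<phi> u) * x u) r - of_real r * \<Lambda> x r"
      by (intro tendsto_intros lim cont\<phi>x x)
    ultimately show "\<Lambda> (\<lambda>u. of_real (\<phi> u) * x u) r = of_real r * \<Lambda> x r"
      using LIMSEQ_unique by fastforce
  next
    have "average (D n) (\<lambda>_. 1 :: 'b) r\<^sub>0 = of_real (\<psi> r\<^sub>0)" for n
    proof -
      have "average (D n) (\<lambda>_. 1 :: 'b) r\<^sub>0 = (\<Sum>p\<leftarrow>D n. fst p r\<^sub>0) *\<^sub>R 1"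
        unfolding average_def sum_list_scaleR_left by simp
      then show ?thesis by (simp add: weights of_real_def)
    qed
    then show "\<Lambda> (\<lambda>_. 1) r\<^sub>0 = 1"
      unfolding \<Lambda>_def by (simp add: \<psi>_def)
  qed
qed

end

section \<open>Operators commuting with a multiplication operator\<close>

lemma multiplication_operator_in_commutant:
  "multiplication_operator y \<in> commutant {multiplication_operator f}"
  unfolding commutant_def scalar_linear_operators_def
  by (auto intro!: bcontfun_eqI blinfun_eqI simp: algebra_simps)

text \<open>Multiplication operators commute with each other, so \<open>G x = G (x * 1) = x * G 1\<close>.\<close>

lemma double_commutant_multiplication:
  assumes "G \<in> double_commutant {multiplication_operator f}"
  shows "G = multiplication_operator (blinfun_apply G (const_bcontfun 1))"
proof (rule blinfun_eqI)
  fix x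
  have "G o\<^sub>L multiplication_operator x = multiplication_operator x o\<^sub>L G"
    using assms multiplication_operator_in_commutant[of x f]
    unfolding double_commutant_def commutant_def[of "commutant _"] by blast
  then have "blinfun_apply G (mult_bcontfun x (const_bcontfun 1))
      = mult_bcontfun x (blinfun_apply G (const_bcontfun 1))"
    by (metis blinfun_apply_blinfun_compose multiplication_operator.rep_eq)
  moreover have "mult_bcontfun x (const_bcontfun 1) = x"
    by (rule bcontfun_eqI) (simp add: const_bcontfun.rep_eq)
  ultimately show "blinfun_apply G x
      = blinfun_apply (multiplication_operator (blinfun_apply G (const_bcontfun 1))) x"
    by (auto intro!: bcontfun_eqI simp: mult.commute)
qed

text \<open>
  The hypotheses on \<open>S\<close> say that it defines a contraction on the continuous functions commuting with
  multiplication by \<open>f\<close>. The conclusion is the equation \<open>S G = G S\<close> evaluated at the constant \<open>1\<close>.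
  Working with plain functions keeps the type of bounded continuous functions out of the
  constructions of \<open>S\<close>.
\<close>

lemma double_commutant_intertwines:
  fixes f :: "'a::topological_space \<Rightarrow>\<^sub>C 'b::real_normed_field"
    and S :: "('a \<Rightarrow> 'b) \<Rightarrow> 'a \<Rightarrow> 'b"
  assumes G: "G \<in> double_commutant {multiplication_operator f}"
    and cont: "\<And>x. continuous_on UNIV x \<Longrightarrow> continuous_on UNIV (S x)"
    and add: "\<And>x y u. continuous_on UNIV x \<Longrightarrow> continuous_on UNIV y \<Longrightarrow>
       S (\<lambda>u. x u + y u) u = S x u + S y u"
    and scale: "\<And>x c u. continuous_on UNIV x \<Longrightarrow> S (\<lambda>u. c * x u) u = c * S x u"
    and bound: "\<And>x B u. continuous_on UNIV x \<Longrightarrow> (\<And>u. norm (x u) \<le> B) \<Longrightarrow> norm (S x u) \<le> B"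
    and commute: "\<And>x u. continuous_on UNIV x \<Longrightarrow> S (\<lambda>u. apply_bcontfun f u * x u) u = apply_bcontfun f u * S x u"
  defines "g \<equiv> apply_bcontfun (blinfun_apply G (const_bcontfun 1))"
  shows "S g u = g u * S (\<lambda>_. 1) u"
proof -
  define T where "T x = Bcontfun (S (apply_bcontfun x))" for x :: "'a \<Rightarrow>\<^sub>C 'b"
  have T: "apply_bcontfun (T x) = S (apply_bcontfun x)" for x
    unfolding T_def
  proof (rule Bcontfun_inverse)
    have "continuous_on UNIV (S (apply_bcontfun x))" by (rule cont) simp
    then show "S (apply_bcontfun x) \<in> bcontfun"
      by (rule bcontfun_normI) (rule bound[of _ "norm x"], simp_all add: norm_bounded)
  qed
  have lin: "bounded_linear T"
  proof (rule bounded_linear_intro[where K = 1])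
    show "T (x + y) = T x + T y" for x y
      by (rule bcontfun_eqI) (simp add: T add plus_bcontfun.rep_eq)
    show "T (r *\<^sub>R x) = r *\<^sub>R T x" for r x
      by (rule bcontfun_eqI) (simp add: T scaleR_bcontfun.rep_eq scaleR_conv_of_real scale)
    show "norm (T x) \<le> norm x * 1" for x
      by (rule norm_bound) (simp add: T bound norm_bounded)
  qed
  define L where "L = Blinfun T"
  have L: "blinfun_apply L = T" unfolding L_def by (rule bounded_linear_Blinfun_apply[OF lin])
  have mult_simp: "apply_bcontfun (mult_bcontfun y x) = (\<lambda>u. apply_bcontfun y u * apply_bcontfun x u)"
    for y x :: "'a \<Rightarrow>\<^sub>C 'b" by (rule ext) simp
  have "L \<in> commutant {multiplication_operator f}"
    unfolding commutant_def scalar_linear_operators_def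
  proof (intro CollectI conjI allI ballI)
    show "blinfun_apply L (mult_bcontfun (const_bcontfun c) x)
        = mult_bcontfun (const_bcontfun c) (blinfun_apply L x)" for c x
      by (rule bcontfun_eqI) (simp add: L T mult_simp const_bcontfun.rep_eq scale)
    fix A assume "A \<in> {multiplication_operator f}"
    then show "L o\<^sub>L A = A o\<^sub>L L"
      by (intro blinfun_eqI bcontfun_eqI) (simp add: L T mult_simp commute)
  qed
  then have GL: "G o\<^sub>L L = L o\<^sub>L G"
    using G unfolding double_commutant_def commutant_def[of "commutant _"] by blast
  have "blinfun_apply L (blinfun_apply G (const_bcontfun 1))
      = blinfun_apply G (blinfun_apply L (const_bcontfun 1))"
    using arg_cong[OF GL, of "\<lambda>A. blinfun_apply A (const_bcontfun 1)"] by simp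
  also have "\<dots> = mult_bcontfun (blinfun_apply G (const_bcontfun 1)) (T (const_bcontfun 1))"
    by (subst double_commutant_multiplication[OF G]) (simp add: L)
  finally have "apply_bcontfun (T (blinfun_apply G (const_bcontfun 1))) u
      = g u * apply_bcontfun (T (const_bcontfun 1)) u"
    by (simp add: L g_def)
  moreover have "apply_bcontfun (const_bcontfun 1 :: 'a \<Rightarrow>\<^sub>C 'b) = (\<lambda>_. 1)"
    by (rule ext) (simp add: const_bcontfun.rep_eq)
  ultimately show ?thesis by (simp add: T g_def)
qed

lemma commutant_iff:
  "T \<in> commutant S \<longleftrightarrow>
     (\<forall>c x. blinfun_apply T (mult_bcontfun (const_bcontfun c) x) =
            mult_bcontfun (const_bcontfun c) (blinfun_apply T x)) \<and>
     (\<forall>A\<in>S. \<forall>x. blinfun_apply T (blinfun_apply A x) = blinfun_apply A (blinfun_apply T x))"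
proof -
  have "T o\<^sub>L A = A o\<^sub>L T \<longleftrightarrow>
      (\<forall>x. blinfun_apply T (blinfun_apply A x) = blinfun_apply A (blinfun_apply T x))" for A
    by (metis blinfun_apply_blinfun_compose blinfun_eqI)
  then show ?thesis unfolding commutant_def scalar_linear_operators_def by simp
qed

lemma mult_bcontfun_add_right: "mult_bcontfun z (x + y) = mult_bcontfun z x + mult_bcontfun z y"
  by (rule bcontfun_eqI) (simp add: plus_bcontfun.rep_eq algebra_simps)

lemma mult_bcontfun_left_commute:
  "mult_bcontfun x (mult_bcontfun y z) = mult_bcontfun y (mult_bcontfun x z)"
  by (rule bcontfun_eqI) simp

lemma closed_commutant: "closed (commutant S)"
proof -
  have "commutant S =
      (\<Inter>c. \<Inter>x. {T. blinfun_apply T (mult_bcontfun (const_bcontfun c) x) =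
         blinfun_apply (multiplication_operator (const_bcontfun c)) (blinfun_apply T x)}) \<inter>
      (\<Inter>A\<in>S. \<Inter>x. {T. blinfun_apply T (blinfun_apply A x) = blinfun_apply A (blinfun_apply T x)})"
    by (auto simp: commutant_iff)
  also have "closed \<dots>"
    by (intro closed_Int closed_INT ballI closed_Collect_eq continuous_intros)
  finally show ?thesis .
qed

lemma unital_algebra_subset_double_commutant:
  "unital_algebra_generated {multiplication_operator f} \<subseteq> double_commutant {multiplication_operator f}"
proof
  fix T assume "T \<in> unital_algebra_generated {multiplication_operator f}"
  then show "T \<in> double_commutant {multiplication_operator f}"
    unfolding double_commutant_def
  proof induction
    case (generator T)
    then show ?case using mult_bcontfun_left_commute[of f] by (auto simp: commutant_iff)
  next
    case identity
    show ?case by (auto simp: commutant_iff)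
  next
    case (add T U)
    then show ?case
      unfolding commutant_iff[of _ "commutant _"]
      by (simp add: blinfun.add_left blinfun.add_right mult_bcontfun_add_right)
  next
    case (scale T c)
    have "blinfun_apply A (mult_bcontfun (const_bcontfun c) x) =
        mult_bcontfun (const_bcontfun c) (blinfun_apply A x)"
      if "A \<in> commutant {multiplication_operator f}" for A x
      using that by (simp add: commutant_iff)
    with scale show ?case
      unfolding commutant_iff[of _ "commutant _"]
      by (simp add: scale_operator_def mult_bcontfun_left_commute[of "const_bcontfun c" "const_bcontfun _"])
  next
    case (compose T U)
    then show ?case unfolding commutant_iff[of _ "commutant _"] by simp
  qed
qed

lemma closure_unital_algebra_subset_double_commutant:
  "closure (unital_algebra_generated {multiplication_operator f})
     \<subseteq> double_commutant {multiplication_operator f}"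
  by (rule closure_minimal[OF unital_algebra_subset_double_commutant])
     (simp add: double_commutant_def closed_commutant)

lemma multiplication_operator_add:
  "multiplication_operator (x + y) = multiplication_operator x + multiplication_operator y"
  by (intro blinfun_eqI bcontfun_eqI) (simp add: plus_bcontfun.rep_eq blinfun.add_left algebra_simps)

lemma multiplication_operator_mult:
  "multiplication_operator (mult_bcontfun x y) = multiplication_operator x o\<^sub>L multiplication_operator y"
  by (intro blinfun_eqI bcontfun_eqI) (simp add: mult.assoc)

lemma norm_multiplication_operator_le: "norm (multiplication_operator x) \<le> norm x"
proof (rule norm_blinfun_bound)
  show "norm (blinfun_apply (multiplication_operator x) y) \<le> norm x * norm y" for y
    by (auto intro!: norm_bound mult_mono simp: norm_mult norm_bounded)
qed simp

text \<open>
  The coefficients of \<open>p\<close> lie in the scalar field, so \<open>p\<close> is decomposed along a real basis of that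
  field into real polynomials, to which the generation of polynomials by sums and products applies.
\<close>

lemma polynomial_in_unital_algebra:
  fixes f :: "'a::topological_space \<Rightarrow>\<^sub>C 'b::{real_normed_field, euclidean_space}"
    and p :: "real \<Rightarrow> 'b"
  assumes f: "\<And>u. apply_bcontfun f u = of_real (\<phi> u)" and p: "polynomial_function p"
  obtains k where "multiplication_operator k \<in> unital_algebra_generated {multiplication_operator f}"
    "\<And>u. apply_bcontfun k u = p (\<phi> u)"
proof -
  let ?A = "unital_algebra_generated {multiplication_operator f}"
  define P where "P q \<longleftrightarrow> (\<exists>k. multiplication_operator k \<in> ?A \<and> (\<forall>u. apply_bcontfun k u = q (\<phi> u)))"
    for q :: "real \<Rightarrow> 'b"
  have P_const: "P (\<lambda>_. c)" for c
  proof -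
    have "multiplication_operator (const_bcontfun c :: 'a \<Rightarrow>\<^sub>C 'b) = scale_operator c id_blinfun"
      unfolding scale_operator_def by (intro blinfun_eqI bcontfun_eqI) simp
    then have "multiplication_operator (const_bcontfun c :: 'a \<Rightarrow>\<^sub>C 'b) \<in> ?A"
      by (simp only: unital_algebra_generated.scale[OF unital_algebra_generated.identity])
    then show ?thesis unfolding P_def
      by (intro exI[of _ "const_bcontfun c"]) (simp add: const_bcontfun.rep_eq)
  qed
  have P_add: "P (\<lambda>r. q r + q' r)" if "P q" "P q'" for q q'
  proof -
    from that obtain k k' where "multiplication_operator k \<in> ?A" "multiplication_operator k' \<in> ?A"
      "\<And>u. apply_bcontfun k u = q (\<phi> u)" "\<And>u. apply_bcontfun k' u = q' (\<phi> u)"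
      unfolding P_def by blast
    then show ?thesis unfolding P_def
      by (intro exI[of _ "k + k'"])
         (simp add: multiplication_operator_add unital_algebra_generated.add plus_bcontfun.rep_eq)
  qed
  have P_mult: "P (\<lambda>r. q r * q' r)" if "P q" "P q'" for q q'
  proof -
    from that obtain k k' where "multiplication_operator k \<in> ?A" "multiplication_operator k' \<in> ?A"
      "\<And>u. apply_bcontfun k u = q (\<phi> u)" "\<And>u. apply_bcontfun k' u = q' (\<phi> u)"
      unfolding P_def by blast
    then show ?thesis unfolding P_def
      by (intro exI[of _ "mult_bcontfun k k'"])
         (simp add: multiplication_operator_mult unital_algebra_generated.compose)
  qed
  have P_real: "P (\<lambda>r. of_real (q r))" if "real_polynomial_function q" for q :: "real \<Rightarrow> real"
    using that
  proof induction
    case (linear q)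
    have "q r = q 1 * r" for r
      using linear_scale[OF bounded_linear.linear[OF linear], of r 1] by (simp add: mult.commute)
    then have eq: "(\<lambda>r. of_real (q r) :: 'b) = (\<lambda>r. of_real (q 1) * of_real r)"
      by (intro ext) (metis of_real_mult)
    have "P of_real"
      unfolding P_def by (intro exI[of _ f]) (simp add: f unital_algebra_generated.generator)
    then show ?case unfolding eq by (rule P_mult[OF P_const])
  qed (use P_const P_add P_mult in auto)
  have "P (\<lambda>r. \<Sum>b\<in>B. of_real (p r \<bullet> b) * b)" if "finite B" "B \<subseteq> Basis" for B
    using that
  proof (induction rule: finite_induct)
    case empty
    show ?case using P_const[of 0] by simp
  next
    case (insert b B)
    then have "real_polynomial_function (\<lambda>r. p r \<bullet> b)"
      using p by (simp add: polynomial_function_iff_Basis_inner)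
    then show ?case using insert P_add[OF P_mult[OF P_real P_const]] by simp
  qed
  from this[of Basis] have "P p"
    by (simp add: scaleR_conv_of_real[symmetric] euclidean_representation)
  then show thesis unfolding P_def using that by blast
qed

section \<open>Fibres on which the double commutant is constant\<close>

definition constant_on_fibre :: "('a \<Rightarrow> real) \<Rightarrow> ('a \<Rightarrow> 'b) \<Rightarrow> real \<Rightarrow> bool" where
  "constant_on_fibre \<phi> g r \<longleftrightarrow> (\<forall>u v. \<phi> u = r \<longrightarrow> \<phi> v = r \<longrightarrow> g u = g v)"

text \<open>
  The operator multiplies the value at one point \<open>s\<close> of the fibre by a bump function inside the
  fibre. It commutes with multiplication by \<open>f\<close> since \<open>f\<close> takes the same value at \<open>s\<close> and wherever
  the bump function does not vanish.
\<close>

lemma (in metrized_compactum) constant_on_plateau: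
  fixes f :: "'a \<Rightarrow>\<^sub>C 'b::real_normed_field"
  assumes f: "\<And>u. apply_bcontfun f u = of_real (\<phi> u)"
    and G: "G \<in> double_commutant {multiplication_operator f}"
    and plateau: "interior (\<phi> -` {r}) \<noteq> {}"
  shows "constant_on_fibre \<phi> (apply_bcontfun (blinfun_apply G (const_bcontfun 1))) r"
proof -
  let ?g = "apply_bcontfun (blinfun_apply G (const_bcontfun 1))"
  obtain t where t: "t \<in> interior (\<phi> -` {r})" using plateau by blast
  obtain w :: "'a \<Rightarrow> real" where w: "continuous_on UNIV w" "\<And>u. 0 \<le> w u" "\<And>u. w u \<le> 1" "w t = 1"
    "\<And>u. w u \<noteq> 0 \<Longrightarrow> u \<in> interior (\<phi> -` {r})"
    using bump_function[OF open_interior t] by blast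
  have flat: "\<phi> u = r" if "w u \<noteq> 0" for u using w(5)[OF that] interior_subset by blast
  have "?g s = ?g t" if s: "\<phi> s = r" for s
  proof -
    have "of_real (w t) * ?g s = ?g t * (of_real (w t) * 1)"
    proof (rule double_commutant_intertwines[OF G, of "\<lambda>x u. of_real (w u) * x s"])
      show "norm (of_real (w u) * x s) \<le> B" if "\<And>u. norm (x u) \<le> B" for x :: "'a \<Rightarrow> 'b" and B u
        using that[of s] w(2,3)[of u] mult_left_le_one_le[of "norm (x s)" "w u"]
        by (simp add: norm_mult)
      show "of_real (w u) * (apply_bcontfun f s * x s) = apply_bcontfun f u * (of_real (w u) * x s)"
        for x :: "'a \<Rightarrow> 'b" and u
        using flat[of u] s by (cases "w u = 0") (auto simp: f)
    qed (auto intro!: continuous_intros w simp: algebra_simps)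
    then show ?thesis by (simp add: w(4))
  qed
  then show ?thesis unfolding constant_on_fibre_def by metis
qed

text \<open>
  With the operator \<open>x \<mapsto> \<Lambda> x \<circ> \<phi>\<close>, the value of \<open>g\<close> at a point over \<open>r\<close> is \<open>\<Lambda> g r\<close>, an expression
  in which the point does not occur. The measures live on \<open>C\<close>, but the conclusion concerns the
  fibre in the whole space.
\<close>

lemma (in level_crossing) constant_on_crossed_fibre:
  fixes f :: "'a \<Rightarrow>\<^sub>C 'b::{real_normed_field, banach}"
  assumes f: "\<And>u. apply_bcontfun f u = of_real (\<phi> u)"
    and G: "G \<in> double_commutant {multiplication_operator f}"
    and C: "connected C" "t \<in> C" "\<phi> t \<le> \<alpha>" "t' \<in> C" "\<beta> \<le> \<phi> t'"
    and r: "\<alpha> < r" "r < \<beta>"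
  shows "constant_on_fibre \<phi> (apply_bcontfun (blinfun_apply G (const_bcontfun 1))) r"
proof -
  let ?g = "apply_bcontfun (blinfun_apply G (const_bcontfun 1))"
  show ?thesis
  proof (rule averaging_functional[OF C r])
    fix \<Lambda> :: "('a \<Rightarrow> 'b) \<Rightarrow> real \<Rightarrow> 'b"
    assume \<Lambda>: "\<And>x. continuous_on UNIV x \<Longrightarrow> continuous_on UNIV (\<Lambda> x)"
      "\<And>x y r. continuous_on UNIV x \<Longrightarrow> continuous_on UNIV y \<Longrightarrow>
         \<Lambda> (\<lambda>u. x u + y u) r = \<Lambda> x r + \<Lambda> y r"
      "\<And>x c r. continuous_on UNIV x \<Longrightarrow> \<Lambda> (\<lambda>u. c * x u) r = c * \<Lambda> x r"
      "\<And>x B r. continuous_on UNIV x \<Longrightarrow> (\<And>u. norm (x u) \<le> B) \<Longrightarrow> norm (\<Lambda> x r) \<le> B"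
      "\<And>x r. continuous_on UNIV x \<Longrightarrow> \<Lambda> (\<lambda>u. of_real (\<phi> u) * x u) r = of_real r * \<Lambda> x r"
      "\<Lambda> (\<lambda>_. 1) r = 1"
    have "\<Lambda> ?g (\<phi> u) = ?g u * \<Lambda> (\<lambda>_. 1) (\<phi> u)" for u
    proof (rule double_commutant_intertwines[OF G, of "\<lambda>x u. \<Lambda> x (\<phi> u)"])
      show "continuous_on UNIV (\<lambda>u. \<Lambda> x (\<phi> u))" if "continuous_on UNIV x" for x
        by (rule continuous_on_compose2[OF \<Lambda>(1)[OF that] cont]) simp
    qed (simp_all add: f \<Lambda>)
    then have "?g u = \<Lambda> ?g r" if "\<phi> u = r" for u using that \<Lambda>(6) by (metis mult.right_neutral)
    then show ?thesis unfolding constant_on_fibre_def by metis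
  qed
qed

section \<open>From one set of the exhaustion to the whole space\<close>

lemma dense_meets_open:
  assumes "closure U = UNIV" "open W" "x \<in> W"
  shows "\<exists>u\<in>U. u \<in> W"
  using open_Int_closure_eq_empty[OF assms(2), of U] assms(1,3) by blast

text \<open>Passing to \<open>- \<phi>\<close> exchanges approach from above with approach from below.\<close>

lemma constant_on_fibre_uminus:
  "constant_on_fibre (\<lambda>u. - \<phi> u) g r \<longleftrightarrow> constant_on_fibre \<phi> g (- r)"
proof -
  have "- \<phi> u = r \<longleftrightarrow> \<phi> u = - r" for u by linarith
  then show ?thesis unfolding constant_on_fibre_def by simp
qed

text \<open>
  Only ends \<open>\<alpha>\<close> and \<open>\<beta>\<close> in the range are considered; on a connected space this is density in the
  range.
\<close>

definition fibres_densely_constant :: "('a \<Rightarrow> real) \<Rightarrow> ('a \<Rightarrow> 'b) \<Rightarrow> bool" where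
  "fibres_densely_constant \<phi> g \<longleftrightarrow> (\<forall>\<alpha>\<in>range \<phi>. \<forall>\<beta>\<in>range \<phi>. \<alpha> < \<beta> \<longrightarrow>
     (\<exists>r. \<alpha> < r \<and> r < \<beta> \<and> constant_on_fibre \<phi> g r))"

lemma fibres_densely_constant_uminus:
  assumes "fibres_densely_constant \<phi> g"
  shows "fibres_densely_constant (\<lambda>u. - \<phi> u) g"
  unfolding fibres_densely_constant_def
proof (intro ballI impI)
  fix \<alpha> \<beta> assume "\<alpha> \<in> range (\<lambda>u. - \<phi> u)" "\<beta> \<in> range (\<lambda>u. - \<phi> u)" "\<alpha> < \<beta>"
  then have "- \<beta> \<in> range \<phi>" "- \<alpha> \<in> range \<phi>" "- \<beta> < - \<alpha>" by auto
  then obtain r where "- \<beta> < r" "r < - \<alpha>" "constant_on_fibre \<phi> g r"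
    using assms unfolding fibres_densely_constant_def by blast
  then show "\<exists>r. \<alpha> < r \<and> r < \<beta> \<and> constant_on_fibre (\<lambda>u. - \<phi> u) g r"
    by (intro exI[of _ "- r"]) (auto simp: constant_on_fibre_uminus)
qed

text \<open>
  A point approached from above has a small connected neighbourhood in \<open>C\<close> containing a larger value,
  hence all values in between.
\<close>

lemma values_attained_above:
  fixes \<phi> :: "'a::topological_space \<Rightarrow> real" and g :: "'a \<Rightarrow> 'b::metric_space"
  assumes cont: "continuous_on UNIV \<phi>" "continuous_on UNIV g" and C: "locally connected C"
    and s: "s \<in> C" "s \<in> closure (C \<inter> {u. \<phi> s < \<phi> u})" and "\<epsilon> > 0"
  obtains \<rho> where "\<phi> s < \<rho>" "\<rho> \<in> range \<phi>"
    "\<And>r. \<phi> s < r \<Longrightarrow> r < \<rho> \<Longrightarrow> \<exists>u. \<phi> u = r \<and> dist (g u) (g s) < \<epsilon>"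
proof -
  have "open {u. dist (g u) (g s) < \<epsilon>}"
    by (intro open_Collect_less continuous_intros cont)
  then have "openin (top_of_set C) (C \<inter> {u. dist (g u) (g s) < \<epsilon>})" by (auto simp: openin_open)
  moreover have "s \<in> C \<inter> {u. dist (g u) (g s) < \<epsilon>}" using s \<open>\<epsilon> > 0\<close> by simp
  ultimately obtain V where V: "openin (top_of_set C) V" "connected V" "s \<in> V"
    "V \<subseteq> C \<inter> {u. dist (g u) (g s) < \<epsilon>}"
    using C unfolding Homotopy.locally_connected by metis
  obtain W where W: "open W" "V = C \<inter> W" using V(1) by (auto simp: openin_open)
  have "s \<in> W" using V(3) W(2) by blast
  then obtain v where v: "v \<in> V" "\<phi> s < \<phi> v"
    using s(2) W unfolding closure_iff_nhds_not_empty by blast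
  have "connected (\<phi> ` V)"
    by (intro connected_continuous_image V(2) continuous_on_subset[OF cont(1)]) auto
  then have "r \<in> \<phi> ` V" if "\<phi> s < r" "r < \<phi> v" for r
    using that v(1) V(3) connectedD_interval[of "\<phi> ` V" "\<phi> s" "\<phi> v" r] by simp
  then have "\<exists>u. \<phi> u = r \<and> dist (g u) (g s) < \<epsilon>" if "\<phi> s < r" "r < \<phi> v" for r
    using that V(4) by blast
  with that v(2) show thesis by blast
qed

text \<open>
  Near both points the same values slightly above \<open>r\<close> occur, and among them there is one whose fibre
  is constant; it transfers the value of \<open>g\<close> from one point to the other.
\<close>

lemma equal_if_approached_from_above:
  fixes \<phi> :: "'a::topological_space \<Rightarrow> real" and g :: "'a \<Rightarrow> 'b::metric_space"
  assumes cont: "continuous_on UNIV \<phi>" "continuous_on UNIV g" and C: "locally connected C"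
    and dense: "fibres_densely_constant \<phi> g"
    and s: "s \<in> C" "s \<in> closure (C \<inter> {u. r < \<phi> u})" "\<phi> s = r"
    and t: "t \<in> C" "t \<in> closure (C \<inter> {u. r < \<phi> u})" "\<phi> t = r"
  shows "g s = g t"
proof (rule ccontr)
  assume "g s \<noteq> g t"
  define \<epsilon> where "\<epsilon> = dist (g s) (g t) / 2"
  have "\<epsilon> > 0" using \<open>g s \<noteq> g t\<close> by (simp add: \<epsilon>_def)
  obtain \<rho> where \<rho>: "r < \<rho>" "\<rho> \<in> range \<phi>"
    "\<And>x. r < x \<Longrightarrow> x < \<rho> \<Longrightarrow> \<exists>u. \<phi> u = x \<and> dist (g u) (g s) < \<epsilon>"
    using values_attained_above[OF cont C s(1) _ \<open>\<epsilon> > 0\<close>] s(2,3) by auto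
  obtain \<rho>' where \<rho>': "r < \<rho>'" "\<rho>' \<in> range \<phi>"
    "\<And>x. r < x \<Longrightarrow> x < \<rho>' \<Longrightarrow> \<exists>u. \<phi> u = x \<and> dist (g u) (g t) < \<epsilon>"
    using values_attained_above[OF cont C t(1) _ \<open>\<epsilon> > 0\<close>] t(2,3) by auto
  have "r \<in> range \<phi>" "min \<rho> \<rho>' \<in> range \<phi>" using s(3) \<rho>(2) \<rho>'(2) by (auto simp: min_def)
  moreover have "r < min \<rho> \<rho>'" using \<rho>(1) \<rho>'(1) by simp
  ultimately obtain x where x: "r < x" "x < min \<rho> \<rho>'" "constant_on_fibre \<phi> g x"
    using dense unfolding fibres_densely_constant_def by blast
  obtain u v where uv: "\<phi> u = x" "dist (g u) (g s) < \<epsilon>" "\<phi> v = x" "dist (g v) (g t) < \<epsilon>"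
    using x \<rho>(3)[of x] \<rho>'(3)[of x] by auto
  have "g u = g v" using x(3) uv unfolding constant_on_fibre_def by blast
  then show False
    using uv dist_triangle3[of "g s" "g t" "g u"] by (simp add: \<epsilon>_def)
qed

text \<open>
  Every point of the fibre in \<open>C\<close> is approached from above or from below, and points approached from
  the same side agree. If both kinds occur, connectedness of \<open>C\<close> gives a point approached from both
  sides, which links them.
\<close>

lemma equal_on_fibre_within:
  fixes \<phi> :: "'a::topological_space \<Rightarrow> real" and g :: "'a \<Rightarrow> 'b::metric_space"
  assumes cont: "continuous_on UNIV \<phi>" "continuous_on UNIV g"
    and C: "connected C" "locally connected C" "C \<subseteq> closure (interior C)"
    and dense: "fibres_densely_constant \<phi> g" and flat: "interior (\<phi> -` {r}) = {}"
    and s: "s \<in> C" "\<phi> s = r" and t: "t \<in> C" "\<phi> t = r"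
  shows "g s = g t"
proof -
  let ?N = "closure (C \<inter> {u. \<phi> u < r})" and ?P = "closure (C \<inter> {u. r < \<phi> u})"
  have P: "g u = g v" if "u \<in> C" "u \<in> ?P" "\<phi> u = r" "v \<in> C" "v \<in> ?P" "\<phi> v = r" for u v
    using equal_if_approached_from_above[OF cont C(2) dense that] .
  have N: "g u = g v" if "u \<in> C" "u \<in> ?N" "\<phi> u = r" "v \<in> C" "v \<in> ?N" "\<phi> v = r" for u v
    using equal_if_approached_from_above[OF continuous_on_minus[OF cont(1)] cont(2) C(2)
        fibres_densely_constant_uminus[OF dense], of u "- r" v] that by simp
  have cover: "C \<subseteq> ?N \<union> ?P" by (rule covered_by_both_sides[OF C(3) flat])
  show ?thesis
  proof (cases "?N \<inter> ?P \<inter> C = {}")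
    case True
    then have "?N \<inter> C = {} \<or> ?P \<inter> C = {}"
      using connected_closedD[OF C(1) True cover] by simp
    then show ?thesis
    proof
      assume "?N \<inter> C = {}"
      then have "s \<in> ?P" "t \<in> ?P" using cover s(1) t(1) by blast+
      then show ?thesis using P s t by blast
    next
      assume "?P \<inter> C = {}"
      then have "s \<in> ?N" "t \<in> ?N" using cover s(1) t(1) by blast+
      then show ?thesis using N s t by blast
    qed
  next
    case False
    then obtain z where z: "z \<in> ?N" "z \<in> ?P" "z \<in> C" by blast
    have "\<phi> z = r" using value_on_closure[OF cont(1), of z C r] z by simp
    then have "g u = g z" if "u \<in> C" "\<phi> u = r" for u
      using P[of u z] N[of u z] that z cover by blast
    then show ?thesis using s t by metis
  qed
qed

text \<open>
  A set \<open>K n\<close> far enough in the exhaustion attains every value that the union attains close to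
  \<open>\<phi> s\<close>: if the union has values below \<open>\<phi> s\<close>, then so does \<open>K n\<close>, and connectedness fills the gap;
  likewise above. On the compact set \<open>K n\<close> the function \<open>g\<close> is near \<open>g s\<^sub>0\<close> as soon as \<open>\<phi>\<close> is near
  \<open>\<phi> s\<^sub>0\<close>, and points of the union near \<open>s\<close> carry this over to \<open>s\<close>.
\<close>

lemma fibre_value_from_exhaustion:
  fixes \<phi> :: "'a::topological_space \<Rightarrow> real" and g :: "'a \<Rightarrow> 'b::metric_space"
  assumes cont: "continuous_on UNIV \<phi>" "continuous_on UNIV g"
    and K: "incseq K" "\<And>m. compact (K m)" "\<And>m. connected (K m)" "closure (\<Union>m. K m) = UNIV"
    and eq: "\<And>u v. u \<in> (\<Union>m. K m) \<Longrightarrow> v \<in> (\<Union>m. K m) \<Longrightarrow> \<phi> u = \<phi> v \<Longrightarrow> g u = g v"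
    and s: "s\<^sub>0 \<in> (\<Union>m. K m)" "\<phi> s = \<phi> s\<^sub>0"
  shows "g s = g s\<^sub>0"
proof (rule ccontr)
  assume "g s \<noteq> g s\<^sub>0"
  define \<epsilon> where "\<epsilon> = dist (g s) (g s\<^sub>0) / 2"
  have "\<epsilon> > 0" using \<open>g s \<noteq> g s\<^sub>0\<close> by (simp add: \<epsilon>_def)
  let ?U = "\<Union>m. K m"
  have mono: "u \<in> K n" if "u \<in> K m" "m \<le> n" for u m n using K(1) that by (auto simp: incseq_def)
  have U_mono: "\<exists>m. \<forall>n\<ge>m. u \<in> K n" if "u \<in> ?U" for u using that mono by blast
  obtain m0 where m0: "\<And>n. n \<ge> m0 \<Longrightarrow> s\<^sub>0 \<in> K n" using U_mono[OF s(1)] by blast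
  (* lo is a value attained below phi s, if there is one; otherwise no point of the union has a value
     between lo and phi s, and the second property is vacuous. The choice of hi is symmetric. *)
  obtain lo m1 where lo: "lo < \<phi> s" "\<And>u n. u \<in> ?U \<Longrightarrow> lo < \<phi> u \<Longrightarrow> \<phi> u < \<phi> s \<Longrightarrow> n \<ge> m1 \<Longrightarrow> lo \<in> \<phi> ` K n"
  proof (cases "\<exists>u\<in>?U. \<phi> u < \<phi> s")
    case True
    then obtain u where "u \<in> ?U" "\<phi> u < \<phi> s" by blast
    then show ?thesis using that[of "\<phi> u"] U_mono[of u] by blast
  next
    case False
    show ?thesis by (rule that[of "\<phi> s - 1" 0]) (use False in force)+
  qed
  obtain hi m2 where hi: "\<phi> s < hi" "\<And>u n. u \<in> ?U \<Longrightarrow> \<phi> u < hi \<Longrightarrow> \<phi> s < \<phi> u \<Longrightarrow> n \<ge> m2 \<Longrightarrow> hi \<in> \<phi> ` K n"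
  proof (cases "\<exists>u\<in>?U. \<phi> s < \<phi> u")
    case True
    then obtain u where "u \<in> ?U" "\<phi> s < \<phi> u" by blast
    then show ?thesis using that[of "\<phi> u"] U_mono[of u] by blast
  next
    case False
    show ?thesis by (rule that[of "\<phi> s + 1" 0]) (use False in force)+
  qed
  define n where "n = max m0 (max m1 m2)"
  have n: "s\<^sub>0 \<in> K n" "n \<ge> m1" "n \<ge> m2" using m0 by (auto simp: n_def)
  define Q where "Q = K n \<inter> {u. \<epsilon> \<le> dist (g u) (g s\<^sub>0)}"
  have "closed {u. \<epsilon> \<le> dist (g u) (g s\<^sub>0)}" by (intro closed_Collect_le continuous_intros cont)
  then have "compact Q" unfolding Q_def by (intro compact_Int_closed K(2))
  then have "closed (\<phi> ` Q)"
    by (intro compact_imp_closed compact_continuous_image continuous_on_subset[OF cont(1)]) auto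
  then have "open (\<phi> -` (- (\<phi> ` Q)))" by (intro open_vimage cont(1)) auto
  moreover have "open {u. dist (g u) (g s) < \<epsilon>}" "open {u. lo < \<phi> u}" "open {u. \<phi> u < hi}"
    by (intro open_Collect_less continuous_intros cont)+
  ultimately have o: "open (\<phi> -` (- (\<phi> ` Q)) \<inter> {u. dist (g u) (g s) < \<epsilon>} \<inter> {u. lo < \<phi> u} \<inter> {u. \<phi> u < hi})"
    (is "open ?O") by (intro open_Int)
  have "\<phi> s \<notin> \<phi> ` Q"
  proof
    assume "\<phi> s \<in> \<phi> ` Q"
    then obtain q where q: "q \<in> K n" "\<epsilon> \<le> dist (g q) (g s\<^sub>0)" "\<phi> q = \<phi> s\<^sub>0" using s(2) by (auto simp: Q_def)
    then have "g q = g s\<^sub>0" using eq s(1) by blast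
    then show False using q(2) \<open>\<epsilon> > 0\<close> by simp
  qed
  then have "s \<in> ?O" using lo(1) hi(1) \<open>\<epsilon> > 0\<close> by simp
  from dense_meets_open[OF K(4) o this] obtain u where u: "u \<in> ?U" "u \<in> ?O" by (elim bexE)
  have con: "connected (\<phi> ` K n)"
    by (intro connected_continuous_image K(3) continuous_on_subset[OF cont(1)]) auto
  have "\<phi> u \<in> \<phi> ` K n"
  proof (cases "\<phi> u" "\<phi> s" rule: linorder_cases)
    case less
    have "lo < \<phi> u" using u(2) by blast
    from lo(2)[OF u(1) this less n(2)] have "lo \<in> \<phi> ` K n" .
    moreover have "\<phi> s \<in> \<phi> ` K n" unfolding s(2) using n(1) by (rule imageI)
    ultimately show ?thesis by (rule connectedD_interval[OF con]) (use u(2) less in simp_all)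
  next
    case equal
    then show ?thesis unfolding equal s(2) using n(1) by (intro imageI)
  next
    case greater
    have "\<phi> u < hi" using u(2) by blast
    from hi(2)[OF u(1) this greater n(3)] have hi_in: "hi \<in> \<phi> ` K n" .
    have "\<phi> s \<in> \<phi> ` K n" unfolding s(2) using n(1) by (rule imageI)
    then show ?thesis by (rule connectedD_interval[OF con _ hi_in]) (use u(2) greater in simp_all)
  qed
  then obtain v where v: "v \<in> K n" "\<phi> v = \<phi> u" by auto
  then have "g v = g u" using eq u(1) by blast
  moreover have "dist (g v) (g s\<^sub>0) < \<epsilon>" 
  proof -
    have "\<phi> v \<notin> \<phi> ` Q" using u(2) v(2) by simp
    then have "v \<notin> Q" by blast
    then show ?thesis using v(1) by (simp add: Q_def not_le)
  qed
  moreover have "dist (g u) (g s) < \<epsilon>" using u(2) by simp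
  ultimately show False using dist_triangle3[of "g s" "g s\<^sub>0" "g u"] by (simp add: \<epsilon>_def)
qed

text \<open>
  At an endpoint \<open>r\<close> of the range that \<open>U\<close> does not attain, follow the path from the last time \<open>\<tau>0\<close> at
  which its value is \<open>r\<close>. Just after \<open>\<tau>0\<close> it passes through all values close to \<open>r\<close>, and \<open>g\<close>
  stays close to its value at \<open>\<tau>0\<close>. Every point over \<open>r\<close> is a limit of points of \<open>U\<close>, whose values
  under \<open>g\<close> are those found along the path.
\<close>

lemma fibre_value_from_path:
  fixes \<phi> :: "'a::topological_space \<Rightarrow> real" and g :: "'a \<Rightarrow> 'b::metric_space"
  assumes cont: "continuous_on UNIV \<phi>" "continuous_on UNIV g"
    and U: "closure U = UNIV" "\<And>u. u \<in> U \<Longrightarrow> \<phi> u < r"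
    and eq: "\<And>u v. u \<in> U \<Longrightarrow> \<phi> v = \<phi> u \<Longrightarrow> g v = g u"
    and p: "path p" "\<phi> (pathstart p) = r" "pathfinish p \<in> U"
  shows "\<exists>c. \<forall>v. \<phi> v = r \<longrightarrow> g v = c"
proof -
  have "closed {v. \<phi> v \<le> r}" by (intro closed_Collect_le continuous_intros cont)
  then have "closure U \<subseteq> {v. \<phi> v \<le> r}" by (rule closure_minimal[rotated]) (use U(2) in force)
  then have below: "\<phi> v \<le> r" for v using U(1) by auto
  have contp: "continuous_on {0..1} p" using p(1) by (simp add: path_def)
  have cont\<phi>p: "continuous_on {0..1} (\<lambda>\<tau>. \<phi> (p \<tau>))"
    by (rule continuous_on_compose2[OF cont(1) contp]) simp
  have contgp: "continuous_on {0..1} (\<lambda>\<tau>. g (p \<tau>))"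
    by (rule continuous_on_compose2[OF cont(2) contp]) simp
  let ?Q = "{0..1} \<inter> (\<lambda>\<tau>. \<phi> (p \<tau>)) -` {r}"
  have "closed ?Q" using continuous_closed_preimage[OF cont\<phi>p, of "{r}"] by simp
  then have "compact ?Q" using compact_Int_closed[OF compact_Icc[of 0 "1::real"], of ?Q] by (metis inf.left_idem)
  moreover have "0 \<in> ?Q" using p(2) by (simp add: pathstart_def)
  ultimately obtain \<tau>0 where \<tau>0: "\<tau>0 \<in> ?Q" "\<And>\<tau>. \<tau> \<in> ?Q \<Longrightarrow> \<tau> \<le> \<tau>0"
    using compact_attains_sup[of ?Q] by blast
  have "\<phi> (p 1) < r" using U(2)[OF p(3)] by (simp add: pathfinish_def)
  then have "\<tau>0 \<noteq> 1" using \<tau>0(1) by auto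
  then have "0 \<le> \<tau>0" "\<tau>0 < 1" using \<tau>0(1) by auto
  have after: "\<phi> (p \<tau>) < r" if "\<tau>0 < \<tau>" "\<tau> \<le> 1" for \<tau>
    using \<tau>0(2)[of \<tau>] that \<open>0 \<le> \<tau>0\<close> below[of "p \<tau>"] by force
  have "g v = g (p \<tau>0)" if v: "\<phi> v = r" for v
  proof (rule ccontr)
    assume "g v \<noteq> g (p \<tau>0)"
    define \<epsilon> where "\<epsilon> = dist (g v) (g (p \<tau>0)) / 2"
    have "\<epsilon> > 0" using \<open>g v \<noteq> g (p \<tau>0)\<close> by (simp add: \<epsilon>_def)
    then obtain \<delta> where \<delta>: "\<delta> > 0"
      "\<And>\<tau>. \<tau> \<in> {0..1} \<Longrightarrow> dist \<tau> \<tau>0 < \<delta> \<Longrightarrow> dist (g (p \<tau>)) (g (p \<tau>0)) < \<epsilon>"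
      using contgp \<tau>0(1) unfolding continuous_on_iff by (metis IntE)
    define \<tau>1 where "\<tau>1 = min 1 (\<tau>0 + \<delta> / 2)"
    have \<tau>1: "\<tau>0 < \<tau>1" "\<tau>1 \<le> 1" "\<tau>1 < \<tau>0 + \<delta>" using \<delta>(1) \<open>\<tau>0 < 1\<close> by (auto simp: \<tau>1_def)
    have "open ({u. \<phi> (p \<tau>1) < \<phi> u} \<inter> {u. dist (g u) (g v) < \<epsilon>})"
      by (intro open_Int open_Collect_less continuous_intros cont)
    moreover have "v \<in> {u. \<phi> (p \<tau>1) < \<phi> u} \<inter> {u. dist (g u) (g v) < \<epsilon>}"
      using after[OF \<tau>1(1,2)] v \<open>\<epsilon> > 0\<close> by simp
    ultimately obtain u where u: "u \<in> U" "\<phi> (p \<tau>1) < \<phi> u" "dist (g u) (g v) < \<epsilon>"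
      using dense_meets_open[OF U(1)] by blast
    have top: "\<phi> u \<le> \<phi> (p \<tau>0)" using U(2)[OF u(1)] \<tau>0(1) by simp
    have "continuous_on {\<tau>0..\<tau>1} (\<lambda>\<tau>. \<phi> (p \<tau>))"
      by (rule continuous_on_subset[OF cont\<phi>p]) (use \<tau>1 \<open>0 \<le> \<tau>0\<close> in auto)
    from IVT2'[of "\<lambda>\<tau>. \<phi> (p \<tau>)", OF less_imp_le[OF u(2)] top less_imp_le[OF \<tau>1(1)] this]
    obtain \<tau> where \<tau>: "\<tau>0 \<le> \<tau>" "\<tau> \<le> \<tau>1" "\<phi> (p \<tau>) = \<phi> u" by blast
    have "g (p \<tau>) = g u" by (rule eq[OF u(1) \<tau>(3)])
    moreover have "dist (g (p \<tau>)) (g (p \<tau>0)) < \<epsilon>"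
      using \<tau> \<tau>1 \<open>0 \<le> \<tau>0\<close> by (intro \<delta>(2)) (auto simp: dist_real_def)
    ultimately show False using u(3) dist_triangle3[of "g v" "g (p \<tau>0)" "g u"] by (simp add: \<epsilon>_def)
  qed
  then show ?thesis by blast
qed

text \<open>
  On a compact space \<open>\<phi>\<close> is a closed map, so a function on the range is continuous when its
  composition with \<open>\<phi>\<close> is.
\<close>

lemma factor_through_fibres:
  fixes \<phi> :: "'a::topological_space \<Rightarrow> real" and g :: "'a \<Rightarrow> 'b::topological_space"
  assumes "compact (UNIV :: 'a set)" and cont: "continuous_on UNIV \<phi>" "continuous_on UNIV g"
    and eq: "\<And>u v. \<phi> u = \<phi> v \<Longrightarrow> g u = g v"
  obtains h where "continuous_on (range \<phi>) h" "\<And>u. g u = h (\<phi> u)"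
proof -
  define h where "h r = g (inv \<phi> r)" for r
  have h: "g u = h (\<phi> u)" for u
    unfolding h_def by (rule eq) (simp add: f_inv_into_f)
  have closed_image: "closed (\<phi> ` A)" if "closed A" for A
    using compact_Int_closed[OF assms(1) that] continuous_on_subset[OF cont(1)]
    by (intro compact_imp_closed compact_continuous_image) auto
  have "continuous_on (range \<phi>) h"
  proof (subst continuous_on_closed_vimage[OF closed_image], simp, intro allI impI)
    fix B :: "'b set" assume "closed B"
    then have "closed (g -` B)" by (rule closed_vimage[OF _ cont(2)])
    moreover have "h -` B \<inter> range \<phi> = \<phi> ` (g -` B)" by (auto simp: h)
    ultimately show "closed (h -` B \<inter> range \<phi>)" using closed_image by simp
  qed
  with h that show thesis by blast
qed

section \<open>The double commutant property\<close>

text \<open>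
  The argument is the same for both scalar fields. The class \<open>euclidean_space\<close> provides completeness,
  for the limits of averages, and the Weierstrass theorem for functions with values in the field.
\<close>

theorem exhaustion_double_commutant:
  fixes K :: "nat \<Rightarrow> 'a::topological_space set"
  assumes compact: "compact (UNIV :: 'a set)"
    and metrizable: "metrizable_space (euclidean :: 'a topology)"
    and K: "incseq K" "\<And>m. compact (K m)" "\<And>m. connected (K m)" "\<And>m. locally connected (K m)"
      "\<And>m. K m \<subseteq> closure (interior (K m))" "closure (\<Union>m. K m) = UNIV"
    and paths: "\<And>k. k \<notin> (\<Union>m. K m) \<Longrightarrow>
           \<exists>p. path p \<and> pathstart p = k \<and> pathfinish p \<in> (\<Union>m. K m)"
  shows "double_commutant_property_over TYPE('a) TYPE('b::{real_normed_field, euclidean_space})"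
  unfolding double_commutant_property_over_def
proof (intro allI impI)
  fix f :: "'a \<Rightarrow>\<^sub>C 'b" assume real: "\<forall>t. apply_bcontfun f t \<in> \<real>"
  let ?F = "{multiplication_operator f}"
  define U where "U = (\<Union>m. K m)"
  have dense_U: "closure U = UNIV" using K(6) by (simp add: U_def)
  obtain d :: "'a \<Rightarrow> 'a \<Rightarrow> real" where "metrized_compactum d"
    by (rule metrizable_compactum_metrized[OF metrizable compact])
  then interpret metrized_compactum d .
  have "\<forall>u. \<exists>r. apply_bcontfun f u = of_real r" using real by (auto elim: Reals_cases)
  then obtain \<phi> where f: "\<And>u. apply_bcontfun f u = of_real (\<phi> u)" by (auto dest!: choice)
  have cont: "continuous_on UNIV \<phi>"
  proof -
    have "continuous_on UNIV (\<lambda>u. (apply_bcontfun f u \<bullet> 1) / (1 \<bullet> (1 :: 'b)))"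
      by (intro continuous_intros) auto
    then show ?thesis by (simp add: f of_real_def)
  qed
  have common: "\<exists>m. u \<in> K m \<and> v \<in> K m" if uv: "u \<in> U" "v \<in> U" for u v
  proof -
    obtain i j where "u \<in> K i" "v \<in> K j" using uv unfolding U_def by blast
    then have "u \<in> K (max i j)" "v \<in> K (max i j)"
      using incseqD[OF K(1), of i "max i j"] incseqD[OF K(1), of j "max i j"] by auto
    then show ?thesis by blast
  qed
  have "G \<in> closure (unital_algebra_generated ?F)" if G: "G \<in> double_commutant ?F" for G
  proof -
    define gf where "gf = blinfun_apply G (const_bcontfun 1)"
    define g where "g = apply_bcontfun gf"
    have contg: "continuous_on UNIV g" by (simp add: g_def)
    have dense: "fibres_densely_constant \<phi> g"
      unfolding fibres_densely_constant_def
    proof (intro ballI impI)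
      fix \<alpha> \<beta> assume "\<alpha> \<in> range \<phi>" "\<beta> \<in> range \<phi>" and "\<alpha> < \<beta>"
      then obtain a b where ab: "\<phi> a = \<alpha>" "\<phi> b = \<beta>" by auto
      show "\<exists>r. \<alpha> < r \<and> r < \<beta> \<and> constant_on_fibre \<phi> g r"
      proof (cases "\<exists>r. \<alpha> < r \<and> r < \<beta> \<and> interior (\<phi> -` {r}) \<noteq> {}")
        case True
        then show ?thesis using constant_on_plateau[OF f G] unfolding g_def gf_def by blast
      next
        case False
        (* points of the exhaustion come only close to the ends of the interval, hence the middle
           third *)
        define \<alpha>' where "\<alpha>' = (2 * \<alpha> + \<beta>) / 3"
        define \<beta>' where "\<beta>' = (\<alpha> + 2 * \<beta>) / 3"
        have *: "\<alpha> < \<alpha>'" "\<alpha>' < \<beta>'" "\<beta>' < \<beta>" using \<open>\<alpha> < \<beta>\<close> by (auto simp: \<alpha>'_def \<beta>'_def)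
        have "open {u. \<phi> u < \<alpha>'}" "open {u. \<beta>' < \<phi> u}"
          by (intro open_Collect_less continuous_intros cont)+
        then obtain t t' where t: "t \<in> U" "\<phi> t < \<alpha>'" "t' \<in> U" "\<beta>' < \<phi> t'"
          using dense_meets_open[OF dense_U, of "{u. \<phi> u < \<alpha>'}" a]
            dense_meets_open[OF dense_U, of "{u. \<beta>' < \<phi> u}" b] ab * by auto
        obtain m where tK: "t \<in> K m" "t' \<in> K m" using common[OF t(1,3)] by blast
        interpret level_crossing d \<phi> "K m" \<alpha>' \<beta>'
          using K(4,5) cont False * by unfold_locales force+
        obtain r where r: "\<alpha>' < r" "r < \<beta>'" using dense *(2) by blast
        have "constant_on_fibre \<phi> g r"
          unfolding g_def gf_def
          using constant_on_crossed_fibre[OF f G K(3) tK(1) _ tK(2) _ r] t by simp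
        with r * show ?thesis by (intro exI[of _ r]) auto
      qed
    qed
    have on_U: "g u = g v" if uv: "u \<in> U" "v \<in> U" "\<phi> u = \<phi> v" for u v
    proof (cases "interior (\<phi> -` {\<phi> v}) = {}")
      case True
      obtain m where "u \<in> K m" "v \<in> K m" using common[OF uv(1,2)] by blast
      then show ?thesis
        using equal_on_fibre_within[OF cont contg K(3,4,5) dense True] uv(3) by blast
    next
      case False
      from constant_on_plateau[OF f G False] uv(3) show ?thesis
        unfolding constant_on_fibre_def g_def gf_def by blast
    qed
    have from_U: "g v = g u" if "u \<in> U" "\<phi> v = \<phi> u" for u v
      by (rule fibre_value_from_exhaustion[OF cont contg K(1,2,3,6), folded U_def, OF on_U that])
    have "g u = g v" if uv: "\<phi> u = \<phi> v" for u v
    proof (cases "\<phi> u \<in> \<phi> ` U")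
      case True
      then obtain w where "w \<in> U" "\<phi> u = \<phi> w" by blast
      then show ?thesis using from_U uv by metis
    next
      case False
      then have "u \<notin> U" by blast
      from paths[OF this[unfolded U_def], folded U_def] obtain p where p: "path p" "pathstart p = u" "pathfinish p \<in> U"
        by (elim exE conjE)
      (* a value missed by the connected sets K m has the whole union on one side *)
      have one_sided: "\<not> (\<phi> w < \<phi> u \<and> \<phi> u < \<phi> w')" if ww: "w \<in> U" "w' \<in> U" for w w'
      proof
        assume *: "\<phi> w < \<phi> u \<and> \<phi> u < \<phi> w'"
        obtain m where "w \<in> K m" "w' \<in> K m" using common[OF ww] by blast
        moreover have "connected (\<phi> ` K m)"
          by (intro connected_continuous_image K(3) continuous_on_subset[OF cont]) auto
        ultimately have "\<phi> u \<in> \<phi> ` K m"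
          using connectedD_interval[of "\<phi> ` K m" "\<phi> w" "\<phi> w'" "\<phi> u"] * by simp
        also have "\<dots> \<subseteq> \<phi> ` U" by (rule image_mono) (auto simp: U_def)
        finally show False using False by contradiction
      qed
      have ne: "\<phi> w \<noteq> \<phi> u" if "w \<in> U" for w using imageI[OF that, of \<phi>] False by metis
      consider "\<And>w. w \<in> U \<Longrightarrow> \<phi> w < \<phi> u" | "\<And>w. w \<in> U \<Longrightarrow> - \<phi> w < - \<phi> u"
      proof (cases "\<exists>w\<in>U. \<phi> w < \<phi> u")
        case True
        then have "\<phi> w < \<phi> u" if "w \<in> U" for w
        proof -
          obtain w' where "w' \<in> U" "\<phi> w' < \<phi> u" using True by (elim bexE)
          then show ?thesis using one_sided[OF _ that, of w'] ne[OF that] by linarith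
        qed
        then show ?thesis by (rule that(1))
      next
        case False
        then have "- \<phi> w < - \<phi> u" if "w \<in> U" for w using ne[OF that] that by force
        then show ?thesis by (rule that(2))
      qed
      then show ?thesis
      proof cases
        case 1
        have "\<exists>c. \<forall>v. \<phi> v = \<phi> u \<longrightarrow> g v = c"
          by (rule fibre_value_from_path[OF cont contg dense_U 1 from_U p(1) _ p(3)]) (simp_all add: p(2))
        then show ?thesis using uv by metis
      next
        case 2
        have "\<exists>c. \<forall>v. - \<phi> v = - \<phi> u \<longrightarrow> g v = c"
          by (rule fibre_value_from_path[OF continuous_on_minus[OF cont] contg dense_U 2 from_U p(1) _ p(3)])
             (simp_all add: p(2))
        then show ?thesis using uv by metis
      qed
    qed
    then obtain h where h: "continuous_on (range \<phi>) h" "\<And>u. g u = h (\<phi> u)"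
      using factor_through_fibres[OF compact cont contg] by metis
    have "compact (range \<phi>)" by (rule compact_continuous_image[OF cont compact])
    have "\<exists>T\<in>unital_algebra_generated ?F. dist T G < e" if "e > 0" for e
    proof -
      obtain q where q: "polynomial_function q" "\<And>r. r \<in> range \<phi> \<Longrightarrow> norm (h r - q r) < e / 2"
        using Stone_Weierstrass_polynomial_function[OF \<open>compact (range \<phi>)\<close> h(1), of "e / 2"] \<open>e > 0\<close>
        by auto
      obtain k where k: "multiplication_operator k \<in> unital_algebra_generated ?F"
        "\<And>u. apply_bcontfun k u = q (\<phi> u)"
        using polynomial_in_unital_algebra[OF f q(1)] by blast
      have "multiplication_operator k - G = multiplication_operator (k - gf)"
        using double_commutant_multiplication[OF G] multiplication_operator_add[of "k - gf" gf]
        unfolding gf_def by (metis add_diff_cancel_right' diff_add_cancel)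
      moreover have "norm (k - gf) \<le> e / 2"
      proof (rule norm_bound)
        fix u
        have "norm (h (\<phi> u) - q (\<phi> u)) < e / 2" by (rule q(2)) simp
        then show "norm (apply_bcontfun (k - gf) u) \<le> e / 2"
          using h(2)[of u] k(2)[of u] by (simp add: minus_bcontfun.rep_eq g_def norm_minus_commute)
      qed
      ultimately have "dist (multiplication_operator k) G < e"
        using norm_multiplication_operator_le[of "k - gf"] \<open>e > 0\<close> by (simp add: dist_norm)
      with k(1) show ?thesis by blast
    qed
    then show ?thesis unfolding closure_approachable by blast
  qed
  then show "double_commutant ?F = closure (unital_algebra_generated ?F)"
    using closure_unital_algebra_subset_double_commutant by blast
qed

theorem proposition7:
  fixes K :: "nat \<Rightarrow> 'a::topological_space set"
  assumes "compact (UNIV :: 'a set)"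
    and "connected (UNIV :: 'a set)"
    and "metrizable_space (euclidean :: 'a topology)"
    and "\<And>m. compact (K m)"
    and "\<And>m. K m \<subset> K (Suc m)"
    and "\<And>m. connected (K m) \<and> locally connected (K m)"
    and "\<And>m. K m \<subseteq> closure (interior (K m))"
    and "\<And>m x. x \<in> K m \<Longrightarrow> locally_connected_at x (euclidean :: 'a topology)"
    and "closure (\<Union>m. K m) = UNIV"
    and "\<And>k. k \<notin> (\<Union>m. K m) \<Longrightarrow>
           \<exists>p. path p \<and> pathstart p = k \<and> pathfinish p \<in> (\<Union>m. K m)"
  shows "DCP TYPE('a)"
proof -
  have "incseq K" using assms(5) by (intro incseq_SucI) blast
  then show ?thesis
    unfolding DCP_def using assms by (intro conjI exhaustion_double_commutant[of K]) auto
qed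

end
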